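(* Let $\Phi\colon[0,\infty)\to[0,\infty)$ be an $N$-function satisfying the doubling condition and $$\int_1^{\infty}\frac{\Phi(t)}{t^3}\,dt<\infty.$$ Then every homeomorphism $\varphi \colon \partial \mathbb{D} \to \partial \mathbb{D}$ onto $\partial\mathbb{D}$ admits a homeomorphic extension $h \colon \overline{\mathbb{D}} \to \overline{\mathbb{D}}$ (that is, a homeomorphism of $\overline{\mathbb{D}}$ onto $\overline{\mathbb{D}}$ with $h|_{\partial\mathbb{D}}=\varphi$) such that both $h$ and $h^{-1}$ belong to the Orlicz--Sobolev space $W^{1,\Phi}(\mathbb{D}, \mathbb{C})$.
   Context: $\mathbb{D}\subset\mathbb{C}$ is the open unit disk, $\partial\mathbb{D}$ the unit circle, $\overline{\mathbb{D}}$ the closed unit disk. An $N$-function is a function $\Phi\colon[0,\infty)\to[0,\infty)$ that is continuous, convex, increasing, with $\Phi(0)=0$, $\lim_{t\to0^+}\Phi(t)/t=0$ and $\lim_{t\to\infty}\Phi(t)/t=\infty$. $\Phi$ satisfies the doubling condition if there is a constant $C_D\ge 2$ such that $\Phi(2t)\le C_D\Phi(t)$ for all $t\ge0$. The Orlicz--Sobolev space is $$W^{1,\Phi}(\mathbb{D},\mathbb{C})=\left\{f\in W^{1,1}(\mathbb{D},\mathbb{C}):\int_{\mathbb{D}}\Phi(|Df(x)|)\,dx<\infty\right\}.$$ Membership of $h$ and $h^{-1}$ refers to their restrictions to $\mathbb{D}$. *)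

theory Defs
  imports "HOL-Analysis.Analysis"
begin

(* Only the values of Phi on [0,oo) matter. "Increasing" is taken in the weak sense; together
   with convexity and the doubling condition below this already forces strict monotonicity. *)
definition N_function :: "(real \<Rightarrow> real) \<Rightarrow> bool" where
  "N_function \<Phi> \<longleftrightarrow>
     (\<forall>t\<ge>0. \<Phi> t \<ge> 0) \<and> continuous_on {0..} \<Phi> \<and> convex_on {0..} \<Phi> \<and> mono_on {0..} \<Phi> \<and> \<Phi> 0 = 0 \<and>
     ((\<lambda>t. \<Phi> t / t) \<longlongrightarrow> 0) (at_right 0) \<and> filterlim (\<lambda>t. \<Phi> t / t) at_top at_top"

definition doubling :: "(real \<Rightarrow> real) \<Rightarrow> bool" where
  "doubling \<Phi> \<longleftrightarrow> (\<exists>C\<ge>2. \<forall>t\<ge>0. \<Phi> (2 * t) \<le> C * \<Phi> t)"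

(* C^k on the plane: f is totally differentiable with gradient (p, q), and p, q are C^(k-1). *)
fun C_diff :: "nat \<Rightarrow> (complex \<Rightarrow> real) \<Rightarrow> bool" where
  "C_diff 0 f \<longleftrightarrow> continuous_on UNIV f"
| "C_diff (Suc k) f \<longleftrightarrow>
     (\<exists>p q. (\<forall>z. (f has_derivative (\<lambda>v. Re v * p z + Im v * q z)) (at z)) \<and>
            C_diff k p \<and> C_diff k q)"

definition test_function :: "complex set \<Rightarrow> (complex \<Rightarrow> real) \<Rightarrow> bool" where
  "test_function \<Omega> \<eta> \<longleftrightarrow>
     (\<forall>k. C_diff k \<eta>) \<and> compact (closure {z. \<eta> z \<noteq> 0}) \<and> closure {z. \<eta> z \<noteq> 0} \<subseteq> \<Omega>"

definition locally_integrable :: "complex set \<Rightarrow> (complex \<Rightarrow> complex) \<Rightarrow> bool" where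
  "locally_integrable \<Omega> f \<longleftrightarrow> (\<forall>K\<subseteq>\<Omega>. compact K \<longrightarrow> set_integrable lebesgue K f)"

(* G z is the weak differential Df(z), a real-linear map of the plane; G z v is the weak
   derivative of f in the direction v. *)
definition weak_derivative ::
    "complex set \<Rightarrow> (complex \<Rightarrow> complex) \<Rightarrow> (complex \<Rightarrow> complex \<Rightarrow>\<^sub>L complex) \<Rightarrow> bool" where
  "weak_derivative \<Omega> f G \<longleftrightarrow>
     locally_integrable \<Omega> f \<and>
     (\<forall>v. locally_integrable \<Omega> (\<lambda>z. blinfun_apply (G z) v)) \<and>
     (\<forall>\<eta> v. test_function \<Omega> \<eta> \<longrightarrow>
        (LINT z:\<Omega>|lebesgue. frechet_derivative \<eta> (at z) v *\<^sub>R f z) =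
        - (LINT z:\<Omega>|lebesgue. \<eta> z *\<^sub>R blinfun_apply (G z) v))"

definition sobolev_W11 :: "complex set \<Rightarrow> (complex \<Rightarrow> complex) set" where
  "sobolev_W11 \<Omega> =
     {f. set_integrable lebesgue \<Omega> f \<and>
         (\<exists>G. weak_derivative \<Omega> f G \<and>
              (\<forall>v. set_integrable lebesgue \<Omega> (\<lambda>z. blinfun_apply (G z) v)))}"

(* The norm on linear maps is the operator norm; the weak differential is unique up to null
   sets, so the existential quantifiers do not involve a choice. *)
definition orlicz_sobolev :: "(real \<Rightarrow> real) \<Rightarrow> complex set \<Rightarrow> (complex \<Rightarrow> complex) set" where
  "orlicz_sobolev \<Phi> \<Omega> =
     {f \<in> sobolev_W11 \<Omega>.
        \<exists>G. weak_derivative \<Omega> f G \<and> (\<integral>\<^sup>+z\<in>\<Omega>. ennreal (\<Phi> (norm (G z))) \<partial>lebesgue) < \<infinity>}"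

end

theory Submission
  imports Defs
begin

text \<open>
  Lift \<open>\<phi>\<close> to the line as \<open>\<phi> (cis t) = cis (d * F t)\<close> with \<open>F\<close> an increasing homeomorphism commuting with the
  period and \<open>d = \<plusminus>1\<close>. Put \<open>G u = d * F\<^sup>-\<^sup>1 (d * u)\<close>, the conjugate of \<open>F\<^sup>-\<^sup>1\<close> by the reflection \<open>d\<close>. The averages
  \<open>\<alpha> = (id + F) / 2\<close> and \<open>\<beta> = (id + G) / 2\<close> satisfy \<open>\<beta> (d * F t) = d * \<alpha> t\<close> and both expand distances up to the
  factor \<open>1/2\<close>, so it suffices to extend expanding maps: if \<open>E\<^sub>\<alpha>\<close>, \<open>E\<^sub>\<beta>\<close> extend \<open>\<alpha>\<close>, \<open>\<beta>\<close> and
  \<open>\<sigma>\<close> is the identity or complex conjugation, then \<open>h = E\<^sub>\<beta>\<^sup>-\<^sup>1 \<circ> \<sigma> \<circ> E\<^sub>\<alpha>\<close> extends \<open>\<phi>\<close>.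

  In logarithmic coordinates \<open>exp (- y + \<i> t)\<close> the extension \<open>E\<^sub>\<alpha>\<close> replaces \<open>t\<close> by the mean \<open>A(t,y)\<close> of
  \<open>\<alpha>\<close> over \<open>[t - y, t + y]\<close>. Then \<open>\<partial>\<^sub>t A = (\<alpha> (t + y) - \<alpha> (t - y)) / 2y \<ge> 1/2\<close> dominates \<open>\<bar>\<partial>\<^sub>y A\<bar>\<close>, so that
  \<open>E\<^sub>\<alpha>\<^sup>-\<^sup>1\<close> has bounded derivative and \<open>\<bar>DE\<^sub>\<alpha>\<bar> \<le> 4 \<partial>\<^sub>t A\<close>. On a dyadic decomposition of the disk into tiles
  of size \<open>2\<^sup>-\<^sup>n\<close>, the numbers \<open>2\<^sup>-\<^sup>n \<partial>\<^sub>t A\<close> on one level are bounded by increments of \<open>\<alpha>\<close> with bounded sum. Since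
  \<open>\<Phi>\<close> is convex with \<open>\<Phi> 0 = 0\<close>, the level contributes at most a multiple of
  \<open>4\<^sup>-\<^sup>n \<Phi> (C * 2\<^sup>n)\<close> to the energy, and these terms are summable by the integral condition.
\<close>

section \<open>Weak derivatives of functions differentiable off a finite set\<close>

text \<open>The directional derivative is a pointwise limit of difference quotients with step
  \<open>1 / (n + 1)\<close>. Extending \<open>f\<close> by zero off the open set makes each
  quotient Borel, and at a point of \<open>S\<close> only values of \<open>f\<close> itself enter
  once \<open>n\<close> is large.\<close>

lemma borel_measurable_directional_derivative:
  fixes f :: "'a::euclidean_space \<Rightarrow> 'b::euclidean_space"
  assumes S: "open S"
    and der: "\<And>z. z \<in> S \<Longrightarrow> (f has_derivative f' z) (at z)"
  shows "(\<lambda>z. indicator S z *\<^sub>R f' z v) \<in> borel_measurable borel"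
proof -
  define F where "F z = indicator S z *\<^sub>R f z" for z
  have cont: "continuous_on S f"
    using der S by (meson continuous_at_imp_continuous_on has_derivative_continuous)
  have [measurable]: "F \<in> borel_measurable borel"
    unfolding F_def using S cont by (intro borel_measurable_continuous_on_indicator) auto
  have [measurable]: "S \<in> sets borel" using S by auto
  let ?D = "\<lambda>n z. indicator S z *\<^sub>R (real (Suc n) *\<^sub>R (F (z + inverse (real (Suc n)) *\<^sub>R v) - F z))"
  show ?thesis
  proof (rule borel_measurable_LIMSEQ_metric[where f = ?D])
    show "?D n \<in> borel_measurable borel" for n by measurable
    fix z :: 'a
    show "(\<lambda>n. ?D n z) \<longlonglongrightarrow> indicator S z *\<^sub>R f' z v"
    proof (cases "z \<in> S")
      case True
      have "((\<lambda>t. f (z + t *\<^sub>R v)) has_derivative (\<lambda>t. f' z (t *\<^sub>R v))) (at 0)"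
        by (rule has_derivative_compose[of "\<lambda>t. z + t *\<^sub>R v" "\<lambda>t. t *\<^sub>R v" 0 UNIV f "f' z", simplified])
           (auto intro!: derivative_eq_intros der True)
      moreover have "f' z (t *\<^sub>R v) = t *\<^sub>R f' z v" for t
        using der[OF True] by (metis has_derivative_linear linear_cmul)
      ultimately have "((\<lambda>t. f (z + t *\<^sub>R v)) has_vector_derivative f' z v) (at 0)"
        by (simp add: has_vector_derivative_def)
      then have lim: "((\<lambda>t. (f (z + t *\<^sub>R v) - f z) /\<^sub>R t) \<longlongrightarrow> f' z v) (at 0)"
      proof -
        have "((\<lambda>t. norm (f (z + t *\<^sub>R v) - f z - t *\<^sub>R f' z v) / norm t) \<longlongrightarrow> 0) (at 0)"
          using \<open>(_ has_vector_derivative _) _\<close> by (simp add: has_vector_derivative_def has_derivative_at)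
        moreover have "\<forall>\<^sub>F t in at 0. norm (f (z + t *\<^sub>R v) - f z - t *\<^sub>R f' z v) / norm t =
            norm ((f (z + t *\<^sub>R v) - f z) /\<^sub>R t - f' z v)"
        proof (rule eventually_at_filter[THEN iffD2], rule always_eventually, intro allI impI)
          fix t :: real assume "t \<noteq> 0"
          then have "(f (z + t *\<^sub>R v) - f z) /\<^sub>R t - f' z v = (f (z + t *\<^sub>R v) - f z - t *\<^sub>R f' z v) /\<^sub>R t"
            by (simp add: scaleR_diff_right)
          then show "norm (f (z + t *\<^sub>R v) - f z - t *\<^sub>R f' z v) / norm t =
              norm ((f (z + t *\<^sub>R v) - f z) /\<^sub>R t - f' z v)" by (simp add: divide_inverse_commute)
        qed
        ultimately have "((\<lambda>t. norm ((f (z + t *\<^sub>R v) - f z) /\<^sub>R t - f' z v)) \<longlongrightarrow> 0) (at 0)"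
          by (subst (asm) tendsto_cong) auto
        then show ?thesis by (simp add: tendsto_norm_zero_iff LIM_zero_iff)
      qed
      have seq: "filterlim (\<lambda>n. inverse (real (Suc n))) (at 0) sequentially"
        unfolding filterlim_at using LIMSEQ_inverse_real_of_nat by (auto)
      have lim2: "(\<lambda>n. real (Suc n) *\<^sub>R (f (z + inverse (real (Suc n)) *\<^sub>R v) - f z)) \<longlonglongrightarrow> f' z v"
        using filterlim_compose[OF lim seq] by simp
      have "(\<lambda>n. z + inverse (real (Suc n)) *\<^sub>R v) \<longlonglongrightarrow> z + 0 *\<^sub>R v"
        by (intro tendsto_intros LIMSEQ_inverse_real_of_nat)
      then have "\<forall>\<^sub>F n in sequentially. z + inverse (real (Suc n)) *\<^sub>R v \<in> S"
        using S True by (simp add: topological_tendstoD)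
      then have ev: "\<forall>\<^sub>F n in sequentially. ?D n z = real (Suc n) *\<^sub>R (f (z + inverse (real (Suc n)) *\<^sub>R v) - f z)"
        by eventually_elim (use True in \<open>simp add: F_def\<close>)
      show ?thesis using tendsto_cong[OF ev] lim2 True by simp
    qed simp
  qed
qed

text \<open>
  Integrating \<open>u (z + v) - u z = \<integral>\<^bsub>[0,1]\<^esub> \<partial>\<^sub>v u (z + s v) ds\<close> over \<open>z\<close> and exchanging the integrals gives \<open>0\<close> on the left
  and \<open>\<integral> \<partial>\<^sub>v u\<close> on the right, by translation invariance. Only almost every line needs an integrable derivative.
\<close>
lemma integral_directional_derivative_eq_0:
  fixes u :: "'a::euclidean_space \<Rightarrow> 'b::euclidean_space"
  assumes cont: "continuous_on UNIV u" and N: "finite N"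
    and der: "\<And>z. z \<notin> N \<Longrightarrow> (u has_derivative u' z) (at z)"
    and int: "integrable lborel u" "integrable lborel (\<lambda>z. u' z v)"
    and v: "v \<noteq> 0"
  shows "(LINT z|lborel. u' z v) = 0"
proof -
  define w where "w z = u' z v" for z
  have [measurable]: "w \<in> borel_measurable borel" and wint: "integrable lborel w"
    using int(2) unfolding w_def by auto
  have trans: "integrable lborel (\<lambda>z. g (z + c))" "(LINT z|lborel. g (z + c)) = (LINT z|lborel. g z)"
    if "integrable lborel g" for g :: "'a \<Rightarrow> 'b" and c
  proof -
    have [measurable]: "g \<in> borel_measurable borel" using that by auto
    have "integrable (distr lborel borel ((+) c)) g" using that by (simp add: lborel_distr_plus)
    then show "integrable lborel (\<lambda>z. g (z + c))"
      by (subst (asm) integrable_distr_eq) (auto simp: add.commute)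
    have "(LINT z|lborel. g z) = (LINT z|distr lborel borel ((+) c). g z)" by (simp add: lborel_distr_plus)
    also have "\<dots> = (LINT z|lborel. g (z + c))" by (subst integral_distr) (auto simp: add.commute)
    finally show "(LINT z|lborel. g (z + c)) = (LINT z|lborel. g z)" by simp
  qed
  define J where "J = {0..1::real}"
  let ?k = "\<lambda>z s. indicator J s *\<^sub>R w (z + s *\<^sub>R v)"
  have [measurable]: "J \<in> sets borel" unfolding J_def by auto
  have m: "case_prod ?k \<in> borel_measurable (lborel \<Otimes>\<^sub>M lborel)" by measurable
  have prod: "integrable (lborel \<Otimes>\<^sub>M lborel) (case_prod ?k)"
  proof (rule integrableI_bounded[OF m])
    have "(\<integral>\<^sup>+x. ennreal (norm (case_prod ?k x)) \<partial>(lborel \<Otimes>\<^sub>M lborel)) =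
        (\<integral>\<^sup>+s. \<integral>\<^sup>+z. ennreal (norm (?k z s)) \<partial>lborel \<partial>lborel)"
      by (subst lborel_pair.nn_integral_snd[symmetric]) (use m in \<open>auto simp: case_prod_beta'\<close>)
    also have "\<dots> = (\<integral>\<^sup>+s. indicator J s * (\<integral>\<^sup>+z. ennreal (norm (w z)) \<partial>lborel) \<partial>lborel)"
    proof (rule nn_integral_cong)
      fix s :: real
      have "(\<integral>\<^sup>+z. ennreal (norm (?k z s)) \<partial>lborel) =
          (\<integral>\<^sup>+z. indicator J s * ennreal (norm (w (s *\<^sub>R v + z))) \<partial>lborel)"
        by (intro nn_integral_cong) (auto simp: indicator_def add.commute)
      also have "\<dots> = indicator J s * (\<integral>\<^sup>+z. ennreal (norm (w (s *\<^sub>R v + z))) \<partial>lborel)"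
        by (rule nn_integral_cmult) measurable
      also have "(\<integral>\<^sup>+z. ennreal (norm (w (s *\<^sub>R v + z))) \<partial>lborel) =
          (\<integral>\<^sup>+z. ennreal (norm (w z)) \<partial>distr lborel borel ((+) (s *\<^sub>R v)))"
        by (subst nn_integral_distr) auto
      finally show "(\<integral>\<^sup>+z. ennreal (norm (?k z s)) \<partial>lborel) =
          indicator J s * (\<integral>\<^sup>+z. ennreal (norm (w z)) \<partial>lborel)" by (simp add: lborel_distr_plus)
    qed
    also have "\<dots> = (\<integral>\<^sup>+z. ennreal (norm (w z)) \<partial>lborel)"
      by (subst nn_integral_multc) (auto simp: J_def)
    also have "\<dots> < \<infinity>" using wint by (simp add: integrable_iff_bounded)
    finally show "(\<integral>\<^sup>+x. ennreal (norm (case_prod ?k x)) \<partial>(lborel \<Otimes>\<^sub>M lborel)) < \<infinity>" .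
  qed
  have "(LINT s|lborel. (LINT z|lborel. ?k z s)) = (LINT z|lborel. (LINT s|lborel. ?k z s))"
    by (rule lborel_pair.Fubini_integral[OF prod])
  also have "(LINT s|lborel. (LINT z|lborel. ?k z s)) = (LINT s|lborel. indicator J s *\<^sub>R (LINT z|lborel. w z))"
    by (simp add: trans(2)[OF wint])
  also have "\<dots> = (LINT z|lborel. w z)"
    by (subst integral_scaleR_left) (auto simp: J_def)
  also have "(LINT z|lborel. (LINT s|lborel. ?k z s)) = (LINT z|lborel. u (z + v) - u z)"
  proof (rule integral_cong_AE)
    show "(\<lambda>z. LINT s|lborel. ?k z s) \<in> borel_measurable lborel"
      using m by (intro lborel.borel_measurable_lebesgue_integral) auto
    show "(\<lambda>z. u (z + v) - u z) \<in> borel_measurable lborel"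
      using trans(1)[OF int(1), of v] int(1) by (intro borel_measurable_diff) auto
    have "AE z in lborel. integrable lborel (\<lambda>s. ?k z s)"
      using lborel_pair.AE_integrable_fst[OF prod] by simp
    then show "AE z in lborel. (LINT s|lborel. ?k z s) = u (z + v) - u z"
    proof eventually_elim
      case (elim z)
      \<comment> \<open>The line through \<open>z\<close> in direction \<open>v\<close> meets
        \<open>N\<close> in finitely many points because \<open>v \<noteq> 0\<close>; the
        fundamental theorem of calculus tolerates these.\<close>
      have "finite ((\<lambda>s. z + s *\<^sub>R v) -` N)"
        by (rule finite_vimageI[OF N]) (use v in \<open>auto intro!: injI\<close>)
      then have "((\<lambda>s. w (z + s *\<^sub>R v)) has_integral (u (z + 1 *\<^sub>R v) - u (z + 0 *\<^sub>R v))) {0..1}"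
      proof (rule fundamental_theorem_of_calculus_strong)
        show "continuous_on {0..1} (\<lambda>s. u (z + s *\<^sub>R v))"
          by (rule continuous_on_compose2[OF cont]) (auto intro!: continuous_intros)
        fix s assume "s \<in> {0..1} - (\<lambda>s. z + s *\<^sub>R v) -` N"
        then have d: "(u has_derivative u' (z + s *\<^sub>R v)) (at (z + s *\<^sub>R v))" using der by auto
        have "((\<lambda>t. u (z + t *\<^sub>R v)) has_derivative (\<lambda>t. u' (z + s *\<^sub>R v) (t *\<^sub>R v))) (at s)"
          by (rule has_derivative_compose[of "\<lambda>t. z + t *\<^sub>R v" "\<lambda>t. t *\<^sub>R v" s UNIV u, simplified])
             (auto intro!: derivative_eq_intros d)
        moreover have "u' (z + s *\<^sub>R v) (t *\<^sub>R v) = t *\<^sub>R u' (z + s *\<^sub>R v) v" for t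
          using d by (metis has_derivative_linear linear_cmul)
        ultimately show "((\<lambda>s. u (z + s *\<^sub>R v)) has_vector_derivative w (z + s *\<^sub>R v)) (at s)"
          by (simp add: has_vector_derivative_def w_def)
      qed auto
      then have "((\<lambda>s. ?k z s) has_integral (u (z + v) - u z)) UNIV"
        by (intro has_integral_eq[rotated, OF has_integral_restrict_UNIV[THEN iffD2]])
          (auto simp: indicator_def J_def)
      \<comment> \<open>The gauge integral just computed is the Lebesgue integral on the lines where
        Fubini provides integrability.\<close>
      then show ?case using has_integral_integral_lborel[OF elim] has_integral_unique by blast
    qed
  qed
  also have "\<dots> = 0" by (simp add: trans int Bochner_Integration.integral_diff)
  finally show ?thesis by (simp add: w_def)
qed

lemma test_function_gradient:
  assumes "test_function \<Omega> \<eta>"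
  obtains p q where "\<And>z. (\<eta> has_derivative (\<lambda>v. Re v * p z + Im v * q z)) (at z)"
    "continuous_on UNIV p" "continuous_on UNIV q"
proof -
  have "C_diff (Suc 0) \<eta>" using assms unfolding test_function_def by blast
  then show ?thesis using that by auto
qed

text \<open>For a test function \<open>\<eta>\<close> the product \<open>u = \<eta> f\<close> is
  continuous on the plane, compactly supported and differentiable off \<open>N\<close>, so the
  integral of its derivative in direction \<open>v\<close> vanishes. By the product rule this is
  integration by parts.\<close>

lemma weak_derivative_off_finite:
  fixes G :: "complex \<Rightarrow> complex \<Rightarrow>\<^sub>L complex"
  assumes \<Omega>: "open \<Omega>" and N: "finite N" and cont: "continuous_on \<Omega> f"
    and der: "\<And>z. z \<in> \<Omega> - N \<Longrightarrow> (f has_derivative blinfun_apply (G z)) (at z)"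
    and G0: "\<And>z. z \<notin> \<Omega> - N \<Longrightarrow> G z = 0"
    and int: "(\<integral>\<^sup>+z\<in>\<Omega>. ennreal (norm (G z)) \<partial>lebesgue) < \<infinity>"
  shows "weak_derivative \<Omega> f G" and "set_integrable lebesgue \<Omega> (\<lambda>z. blinfun_apply (G z) v)"
proof -
  have [measurable]: "(\<lambda>z. blinfun_apply (G z) v) \<in> borel_measurable borel" for v
  proof -
    have "open (\<Omega> - N)" using \<Omega> N by (simp add: finite_imp_closed open_Diff)
    then have "(\<lambda>z. indicator (\<Omega> - N) z *\<^sub>R blinfun_apply (G z) v) \<in> borel_measurable borel"
      using der by (rule borel_measurable_directional_derivative)
    also have "(\<lambda>z. indicator (\<Omega> - N) z *\<^sub>R blinfun_apply (G z) v) = (\<lambda>z. blinfun_apply (G z) v)"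
      using G0 by (auto simp: indicator_def fun_eq_iff)
    finally show ?thesis .
  qed
  have [measurable]: "\<Omega> \<in> sets borel" using \<Omega> by auto
  have intG: "integrable lborel (\<lambda>z. blinfun_apply (G z) v)" for v
  proof -
    \<comment> \<open>The vector \<open>sgn v\<close> has norm at most 1, which gives the bound
      \<open>norm (G z)\<close> without a factor; scaling by \<open>norm v\<close> recovers
      \<open>v\<close>.\<close>
    have "integrable lborel (\<lambda>z. blinfun_apply (G z) (sgn v))"
    proof (rule integrableI_bounded)
      have "(\<integral>\<^sup>+z. ennreal (norm (blinfun_apply (G z) (sgn v))) \<partial>lborel) \<le>
          (\<integral>\<^sup>+z\<in>\<Omega>. ennreal (norm (G z)) \<partial>lborel)"
      proof (rule nn_integral_mono)
        fix z
        have "norm (blinfun_apply (G z) (sgn v)) \<le> norm (G z) * norm (sgn v)" by (rule norm_blinfun)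
        also have "\<dots> \<le> norm (G z)" by (simp add: norm_sgn)
        finally show "ennreal (norm (blinfun_apply (G z) (sgn v))) \<le> ennreal (norm (G z)) * indicator \<Omega> z"
          using G0[of z] by (auto simp: indicator_def intro: ennreal_leI)
      qed
      also have "\<dots> < \<infinity>" using int by (simp add: nn_integral_completion)
      finally show "(\<integral>\<^sup>+z. ennreal (norm (blinfun_apply (G z) (sgn v))) \<partial>lborel) < \<infinity>" .
    qed simp
    then have "integrable lborel (\<lambda>z. norm v *\<^sub>R blinfun_apply (G z) (sgn v))" by simp
    moreover have "norm v *\<^sub>R sgn v = v" by (cases "v = 0") (simp_all add: sgn_div_norm)
    ultimately show ?thesis by (simp only: blinfun.scaleR_right[symmetric])
  qed
  have intGl: "set_integrable lebesgue S (\<lambda>z. blinfun_apply (G z) v)" if [measurable]: "S \<in> sets borel" for S v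
  proof -
    have "set_integrable lborel S (\<lambda>z. blinfun_apply (G z) v)"
      using set_integrable_subset[of lborel UNIV "\<lambda>z. blinfun_apply (G z) v" S] intG[of v]
      by (simp add: set_integrable_def)
    then show ?thesis by (simp add: set_integrable_def integrable_completion)
  qed
  show "set_integrable lebesgue \<Omega> (\<lambda>z. blinfun_apply (G z) v)" by (rule intGl) simp
  have parts: "(LINT z:\<Omega>|lebesgue. frechet_derivative \<eta> (at z) v *\<^sub>R f z) =
        - (LINT z:\<Omega>|lebesgue. \<eta> z *\<^sub>R blinfun_apply (G z) v)" if \<eta>: "test_function \<Omega> \<eta>" for \<eta> v
  proof (cases "v = 0")
    case True
    obtain p q where d: "\<And>z. (\<eta> has_derivative (\<lambda>v. Re v * p z + Im v * q z)) (at z)"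
      using test_function_gradient[OF \<eta>] by metis
    show ?thesis using True frechet_derivative_at[OF d, symmetric] by (simp add: set_lebesgue_integral_def)
  next
    case False
    obtain p q where d: "\<And>z. (\<eta> has_derivative (\<lambda>v. Re v * p z + Im v * q z)) (at z)"
      and pq: "continuous_on UNIV p" "continuous_on UNIV q"
      using test_function_gradient[OF \<eta>] by metis
    define \<eta>' where "\<eta>' z v = Re v * p z + Im v * q z" for z v
    have fr: "frechet_derivative \<eta> (at z) = \<eta>' z" for z
      using frechet_derivative_at[OF d[of z]] by (simp add: \<eta>'_def fun_eq_iff)
    define K where "K = closure {z. \<eta> z \<noteq> 0}"
    have K: "compact K" "K \<subseteq> \<Omega>" using \<eta> by (auto simp: test_function_def K_def)
    have Ko: "open (- K)" using K by (simp add: compact_imp_closed open_Compl)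
    have [measurable]: "K \<in> sets borel" using K by (simp add: compact_imp_closed borel_closed)
    have \<eta>0: "\<eta> z = 0" if "z \<notin> K" for z
      using that subsetD[OF closure_subset, of z "{z. \<eta> z \<noteq> 0}"] by (auto simp: K_def)
    have \<eta>c: "continuous_on UNIV \<eta>" using d by (meson continuous_at_imp_continuous_on has_derivative_continuous)
    have \<eta>'0: "\<eta>' z w = 0" if "z \<notin> K" for z w
    proof -
      have "(\<eta> has_derivative (\<lambda>_. 0)) (at z)"
        by (rule has_derivative_transform_within_open[OF _ Ko]) (use that \<eta>0 in auto)
      then have "frechet_derivative \<eta> (at z) = (\<lambda>_. 0)" by (metis frechet_derivative_at)
      then show ?thesis by (simp add: fr fun_eq_iff)
    qed
    have \<eta>'c: "continuous_on UNIV (\<lambda>z. \<eta>' z v)"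
      unfolding \<eta>'_def by (intro continuous_intros pq)
    have fK: "continuous_on K f" using cont K continuous_on_subset by blast
    define u where "u z = \<eta> z *\<^sub>R f z" for z
    define u' where "u' z w = \<eta>' z w *\<^sub>R f z + \<eta> z *\<^sub>R blinfun_apply (G z) w" for z w
    have i1: "integrable lborel (\<lambda>z. \<eta>' z v *\<^sub>R f z)"
    proof -
      have "integrable lborel (\<lambda>z. indicator K z *\<^sub>R (\<eta>' z v *\<^sub>R f z))"
        by (intro borel_integrable_compact K continuous_intros fK continuous_on_subset[OF \<eta>'c]) auto
      also have "(\<lambda>z. indicator K z *\<^sub>R (\<eta>' z v *\<^sub>R f z)) = (\<lambda>z. \<eta>' z v *\<^sub>R f z)"
        using \<eta>'0 by (auto simp: indicator_def fun_eq_iff)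
      finally show ?thesis .
    qed
    have i0: "integrable lborel u"
    proof -
      have "integrable lborel (\<lambda>z. indicator K z *\<^sub>R (\<eta> z *\<^sub>R f z))"
        by (intro borel_integrable_compact K continuous_intros fK continuous_on_subset[OF \<eta>c]) auto
      also have "(\<lambda>z. indicator K z *\<^sub>R (\<eta> z *\<^sub>R f z)) = u"
        using \<eta>0 by (auto simp: indicator_def fun_eq_iff u_def)
      finally show ?thesis .
    qed
    have i2: "integrable lborel (\<lambda>z. \<eta> z *\<^sub>R blinfun_apply (G z) v)"
    proof -
      have "compact (\<eta> ` K)" using K \<eta>c compact_continuous_image continuous_on_subset by blast
      then obtain B where B: "\<And>z. z \<in> K \<Longrightarrow> \<bar>\<eta> z\<bar> \<le> B"
        by (metis compact_imp_bounded bounded_iff imageI real_norm_def)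
      have [measurable]: "\<eta> \<in> borel_measurable borel" using \<eta>c by (rule borel_measurable_continuous_onI)
      have "integrable lborel (\<lambda>z. \<bar>B\<bar> *\<^sub>R blinfun_apply (G z) v)" using intG by simp
      then show ?thesis
      proof (rule Bochner_Integration.integrable_bound)
        have "\<bar>\<eta> z\<bar> \<le> \<bar>B\<bar>" for z using B[of z] \<eta>0[of z] by (cases "z \<in> K") auto
        then show "AE z in lborel. norm (\<eta> z *\<^sub>R blinfun_apply (G z) v) \<le> norm (\<bar>B\<bar> *\<^sub>R blinfun_apply (G z) v)"
          by (auto intro!: mult_right_mono)
      qed simp
    qed
    have "(LINT z|lborel. u' z v) = 0"
    proof (rule integral_directional_derivative_eq_0[OF _ N _ i0 _ False])
      \<comment> \<open>\<open>f\<close> is controlled only on \<open>\<Omega>\<close>, but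
        \<open>\<Omega>\<close> and the complement of the support \<open>K\<close> are open and
        cover the plane, and \<open>u\<close> is zero on the latter.\<close>
      have "continuous_on (\<Omega> \<union> - K) u"
      proof (rule continuous_on_open_Un[OF \<Omega> Ko])
        show "continuous_on \<Omega> u" unfolding u_def
          by (intro continuous_intros cont continuous_on_subset[OF \<eta>c]) auto
        show "continuous_on (- K) u"
          by (rule continuous_on_eq[of _ "\<lambda>_. 0"]) (auto simp: u_def \<eta>0)
      qed
      also have "\<Omega> \<union> - K = UNIV" using K by auto
      finally show "continuous_on UNIV u" .
      show "integrable lborel (\<lambda>z. u' z v)" unfolding u'_def using i1 i2 by simp
      fix z assume z: "z \<notin> N"
      show "(u has_derivative u' z) (at z)"
      proof (cases "z \<in> \<Omega>")
        case True
        then have "(f has_derivative blinfun_apply (G z)) (at z)" using z der by auto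
        then show ?thesis unfolding u_def u'_def \<eta>'_def
          by (auto intro!: derivative_eq_intros d simp: algebra_simps)
      next
        case False
        then have zK: "z \<in> - K" using K by auto
        have "u' z = (\<lambda>_. 0)" using zK by (auto simp: u'_def \<eta>0 \<eta>'0)
        then show ?thesis
          by simp (rule has_derivative_transform_within_open[OF _ Ko zK], auto simp: u_def \<eta>0)
      qed
    qed
    then have "(LINT z|lborel. \<eta>' z v *\<^sub>R f z) = - (LINT z|lborel. \<eta> z *\<^sub>R blinfun_apply (G z) v)"
      unfolding u'_def using i1 i2 by (simp add: eq_neg_iff_add_eq_0)
    moreover have "(LINT z:\<Omega>|lebesgue. \<eta>' z v *\<^sub>R f z) = (LINT z|lborel. \<eta>' z v *\<^sub>R f z)"
    proof -
      have "(LINT z:\<Omega>|lebesgue. \<eta>' z v *\<^sub>R f z) = (LINT z|lebesgue. \<eta>' z v *\<^sub>R f z)"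
        unfolding set_lebesgue_integral_def using K \<eta>'0
        by (intro Bochner_Integration.integral_cong) (auto simp: indicator_def)
      then show ?thesis using i1 by (subst (asm) integral_completion) auto
    qed
    moreover have "(LINT z:\<Omega>|lebesgue. \<eta> z *\<^sub>R blinfun_apply (G z) v) = (LINT z|lborel. \<eta> z *\<^sub>R blinfun_apply (G z) v)"
    proof -
      have "(LINT z:\<Omega>|lebesgue. \<eta> z *\<^sub>R blinfun_apply (G z) v) = (LINT z|lebesgue. \<eta> z *\<^sub>R blinfun_apply (G z) v)"
        unfolding set_lebesgue_integral_def using K \<eta>0
        by (intro Bochner_Integration.integral_cong) (auto simp: indicator_def)
      then show ?thesis using i2 by (subst (asm) integral_completion) auto
    qed
    ultimately show ?thesis by (simp add: fr)
  qed
  have "locally_integrable \<Omega> f"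
    unfolding locally_integrable_def
  proof (intro allI impI)
    fix K assume "K \<subseteq> \<Omega>" "compact K"
    then have "integrable lborel (\<lambda>z. indicator K z *\<^sub>R f z)"
      using cont by (intro borel_integrable_compact) (auto intro: continuous_on_subset)
    then show "set_integrable lebesgue K f"
      unfolding set_integrable_def by (subst integrable_completion) auto
  qed
  moreover have "locally_integrable \<Omega> (\<lambda>z. blinfun_apply (G z) v)" for v
    unfolding locally_integrable_def using intGl by (auto simp: compact_imp_closed borel_closed)
  ultimately show "weak_derivative \<Omega> f G"
    using parts unfolding weak_derivative_def by blast
qed

text \<open>A pointwise majorant \<open>\<mu>\<close> of the operator norm transfers both integral
  conditions by monotonicity. At the origin, where differentiability may fail, the weak differential
  is set to 0, matching \<open>\<mu> 0 = 0\<close>.\<close>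

lemma orlicz_sobolevI:
  assumes cont: "continuous_on (cball 0 1) f"
    and der: "\<And>z. z \<in> ball 0 1 - {0} \<Longrightarrow> (f has_derivative f' z) (at z)"
    and bound: "\<And>z. z \<in> ball 0 1 - {0} \<Longrightarrow> onorm (f' z) \<le> \<mu> z"
    and \<mu>0: "\<mu> 0 = 0"
    and mono: "mono_on {0..} \<Phi>"
    and int: "(\<integral>\<^sup>+z\<in>ball 0 1. ennreal (\<mu> z) \<partial>lebesgue) < \<infinity>"
       "(\<integral>\<^sup>+z\<in>ball 0 1. ennreal (\<Phi> (\<mu> z)) \<partial>lebesgue) < \<infinity>"
  shows "f \<in> orlicz_sobolev \<Phi> (ball 0 1)"
proof -
  define G where "G z = (if z \<in> ball 0 1 - {0} then Blinfun (f' z) else 0)" for z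
  have G: "blinfun_apply (G z) = f' z" if "z \<in> ball 0 1 - {0}" for z
    using that bounded_linear_Blinfun_apply[OF has_derivative_bounded_linear[OF der[OF that]]] by (simp add: G_def)
  have nG: "norm (G z) \<le> \<mu> z" if "z \<in> ball 0 1" for z
  proof (cases "z = 0")
    case False
    then show ?thesis using that bound[of z] G[of z] by (simp add: norm_blinfun.rep_eq)
  qed (simp add: G_def \<mu>0)
  have "(\<integral>\<^sup>+z\<in>ball 0 1. ennreal (norm (G z)) \<partial>lebesgue) \<le> (\<integral>\<^sup>+z\<in>ball 0 1. ennreal (\<mu> z) \<partial>lebesgue)"
    using nG by (intro nn_integral_mono) (auto simp: indicator_def intro!: ennreal_leI)
  with int have iG: "(\<integral>\<^sup>+z\<in>ball 0 1. ennreal (norm (G z)) \<partial>lebesgue) < \<infinity>" by auto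
  have c: "continuous_on (ball 0 1) f" using cont by (rule continuous_on_subset) auto
  note w = weak_derivative_off_finite[OF open_ball _ c _ _ iG, where N = "{0}"]
  have wd: "weak_derivative (ball 0 1) f G" by (rule w) (use der G in \<open>auto simp: G_def\<close>)
  have si: "set_integrable lebesgue (ball 0 1) (\<lambda>z. blinfun_apply (G z) v)" for v
    by (rule w) (use der G in \<open>auto simp: G_def\<close>)
  have "integrable lborel (\<lambda>z. indicator (cball 0 1) z *\<^sub>R f z)"
    by (intro borel_integrable_compact cont) auto
  then have "set_integrable lebesgue (cball 0 1) f"
    unfolding set_integrable_def by (subst integrable_completion) auto
  then have "set_integrable lebesgue (ball 0 1) f"
    by (rule set_integrable_subset) auto
  moreover have "(\<integral>\<^sup>+z\<in>ball 0 1. ennreal (\<Phi> (norm (G z))) \<partial>lebesgue) \<le> (\<integral>\<^sup>+z\<in>ball 0 1. ennreal (\<Phi> (\<mu> z)) \<partial>lebesgue)"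
  proof (rule nn_integral_mono)
    fix z :: complex
    have "\<Phi> (norm (G z)) \<le> \<Phi> (\<mu> z)" if "z \<in> ball 0 1"
      using nG[OF that] norm_ge_zero[of "G z"] by (intro mono_onD[OF mono]) (auto simp del: norm_ge_zero)
    then show "ennreal (\<Phi> (norm (G z))) * indicator (ball 0 1) z \<le> ennreal (\<Phi> (\<mu> z)) * indicator (ball 0 1) z"
      by (auto simp: indicator_def intro!: ennreal_leI)
  qed
  ultimately show ?thesis
    using wd si int unfolding orlicz_sobolev_def sobolev_W11_def by auto
qed

section \<open>Means of expanding lifts\<close>

text \<open>\<open>\<alpha>\<close> lifts an orientation-preserving circle homeomorphism whose
  inverse lift is 2-Lipschitz. The constant \<open>1/2\<close> survives averaging and bounds the
  derivative in \<open>t\<close> from below.\<close>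

locale expanding_lift =
  fixes \<alpha> :: "real \<Rightarrow> real"
  assumes cont: "continuous_on UNIV \<alpha>"
    and shift: "\<alpha> (x + 2 * pi) = \<alpha> x + 2 * pi"
    and expand: "x \<le> y \<Longrightarrow> (y - x) / 2 \<le> \<alpha> y - \<alpha> x"
begin

lemma mono: "x \<le> y \<Longrightarrow> \<alpha> x \<le> \<alpha> y"
  using expand[of x y] by simp

lemma shift_of_int: "\<alpha> (x + 2 * pi * of_int k) = \<alpha> x + 2 * pi * of_int k"
proof (induction k rule: int_induct[where k = 0])
  case (step1 i)
  then show ?case using shift[of "x + 2 * pi * of_int i"] by (simp add: algebra_simps)
next
  case (step2 i)
  then show ?case using shift[of "x + 2 * pi * of_int (i - 1)"] by (simp add: algebra_simps)
qed simp

text \<open>The additive constant is immaterial, since only differences of values enter.\<close>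

definition primitive :: "real \<Rightarrow> real" where
  "primitive = (SOME F. \<forall>x. (F has_real_derivative \<alpha> x) (at x))"

lemma primitive_deriv: "(primitive has_real_derivative \<alpha> x) (at x)"
proof -
  have "\<exists>F. \<forall>x::real. -\<infinity> < ereal x \<longrightarrow> ereal x < \<infinity> \<longrightarrow> (F has_vector_derivative \<alpha> x) (at x)"
    by (rule einterval_antiderivative) (use cont in \<open>auto simp: continuous_on_eq_continuous_at\<close>)
  then have "\<exists>F. \<forall>x. (F has_real_derivative \<alpha> x) (at x)"
    by (simp add: has_real_derivative_iff_has_vector_derivative)
  then show ?thesis unfolding primitive_def by (rule someI2_ex) blast
qed

text \<open>This is the average \<open>A(t,y)\<close>, with its limit as the value at
  \<open>y = 0\<close>. For \<open>y > 0\<close> the functions \<open>slope\<close> and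
  \<open>mean_dy\<close> below are its partial derivatives in \<open>t\<close> and
  \<open>y\<close>.\<close>

definition mean :: "real \<Rightarrow> real \<Rightarrow> real" where
  "mean t y = (if y = 0 then \<alpha> t else (primitive (t + y) - primitive (t - y)) / (2 * y))"

definition slope :: "real \<Rightarrow> real \<Rightarrow> real" where
  "slope t y = (\<alpha> (t + y) - \<alpha> (t - y)) / (2 * y)"

definition mean_dy :: "real \<Rightarrow> real \<Rightarrow> real" where
  "mean_dy t y = ((\<alpha> (t + y) + \<alpha> (t - y)) / 2 - mean t y) / y"

text \<open>For \<open>y > 0\<close> the mean value theorem for the primitive makes the average a
  value of \<open>\<alpha>\<close> at an interior point.\<close>

lemma mean_bounds:
  assumes "y \<ge> 0" shows "\<alpha> (t - y) \<le> mean t y" "mean t y \<le> \<alpha> (t + y)"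
proof -
  have "\<alpha> (t - y) \<le> mean t y \<and> mean t y \<le> \<alpha> (t + y)"
  proof (cases "y = 0")
    case False
    then obtain \<xi> where \<xi>: "t - y < \<xi>" "\<xi> < t + y"
      "primitive (t + y) - primitive (t - y) = (t + y - (t - y)) * \<alpha> \<xi>"
      using MVT2[of "t - y" "t + y" primitive \<alpha>, OF _ primitive_deriv] assms by (auto simp del: add_diff_cancel)
    then have "mean t y = \<alpha> \<xi>" using False by (simp add: mean_def)
    then show ?thesis using \<xi> mono by simp
  qed (simp add: mean_def)
  then show "\<alpha> (t - y) \<le> mean t y" "mean t y \<le> \<alpha> (t + y)" by auto
qed

lemma slope_ge: "y > 0 \<Longrightarrow> slope t y \<ge> 1 / 2"
  using expand[of "t - y" "t + y"] by (simp add: slope_def field_simps)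

text \<open>The average and the midpoint of the two end values lie in the same interval of values,
  so they differ by at most half its length.\<close>

lemma mean_dy_bound:
  assumes "y > 0" shows "\<bar>mean_dy t y\<bar> \<le> slope t y"
proof -
  have "\<bar>(\<alpha> (t + y) + \<alpha> (t - y)) / 2 - mean t y\<bar> \<le> (\<alpha> (t + y) - \<alpha> (t - y)) / 2"
    using mean_bounds[of y t] assms by (simp add: abs_le_iff field_simps)
  then show ?thesis using assms by (simp add: mean_dy_def slope_def abs_divide divide_right_mono field_simps)
qed

text \<open>Translation by \<open>c\<close> changes the primitive by \<open>c * x\<close> plus a
  constant, as differentiation shows; the constant cancels in the difference.\<close>

lemma mean_shift: "mean (t + 2 * pi * of_int k) y = mean t y + 2 * pi * of_int k"
proof (cases "y = 0")
  case False
  define c where "c = 2 * pi * of_int k"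
  define D where "D x = primitive (x + c) - primitive x - c * x" for x
  have "(D has_real_derivative 0) (at x)" for x
  proof -
    have "((\<lambda>x. primitive (x + c)) has_real_derivative \<alpha> (x + c)) (at x)"
      using primitive_deriv[of "x + c"] by (simp add: DERIV_shift)
    then show ?thesis unfolding D_def
      by (auto intro!: derivative_eq_intros primitive_deriv simp: shift_of_int c_def)
  qed
  then have "D (t + y) = D (t - y)" by (meson DERIV_isconst_all)
  then have "primitive (t + c + y) - primitive (t + c - y) = primitive (t + y) - primitive (t - y) + c * (2 * y)"
    by (simp add: D_def algebra_simps)
  then show ?thesis using False by (simp add: mean_def c_def[symmetric] add_divide_distrib)
qed (simp add: mean_def shift_of_int)

lemma mean_has_derivative:
  assumes "y > 0"
  shows "((\<lambda>p. mean (fst p) (snd p)) has_derivative (\<lambda>(a, b). slope t y * a + mean_dy t y * b)) (at (t, y))"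
proof -
  have P: "(primitive has_derivative (\<lambda>h. h * \<alpha> x)) (at x)" for x
    using primitive_deriv[of x] by (simp add: has_field_derivative_def mult.commute[of "\<alpha> x"] mult_commute_abs)
  have "((\<lambda>p. (primitive (fst p + snd p) - primitive (fst p - snd p)) / (2 * snd p)) has_derivative
        (\<lambda>(a, b). slope t y * a + mean_dy t y * b)) (at (t, y))"
  proof -
    have P1: "((\<lambda>p. primitive (fst p + snd p)) has_derivative (\<lambda>h. (fst h + snd h) * \<alpha> (t + y))) (at (t, y))"
    proof -
      have "((\<lambda>p. fst p + snd p) has_derivative (\<lambda>h. fst h + snd h)) (at (t, y))"
        by (auto intro!: derivative_eq_intros)
      from has_derivative_compose[OF this P] show ?thesis by simp
    qed
    have P2: "((\<lambda>p. primitive (fst p - snd p)) has_derivative (\<lambda>h. (fst h - snd h) * \<alpha> (t - y))) (at (t, y))"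
    proof -
      have "((\<lambda>p. fst p - snd p) has_derivative (\<lambda>h. fst h - snd h)) (at (t, y))"
        by (auto intro!: derivative_eq_intros)
      from has_derivative_compose[OF this P] show ?thesis by simp
    qed
    have S: "((\<lambda>p. 2 * snd p) has_derivative (\<lambda>h. 2 * snd h)) (at (t, y))"
      by (auto intro!: derivative_eq_intros)
    show ?thesis
      by (rule has_derivative_eq_rhs[OF has_derivative_divide[OF has_derivative_diff[OF P1 P2] S]])
        (use assms in \<open>auto simp: fun_eq_iff slope_def mean_dy_def mean_def divide_simps, simp add: algebra_simps\<close>)
  qed
  moreover have "open {p :: real \<times> real. snd p > 0}"
    by (intro open_Collect_less continuous_intros)
  ultimately show ?thesis
    by (rule has_derivative_transform_within_open) (use assms in \<open>auto simp: mean_def\<close>)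
qed

text \<open>For \<open>y > 0\<close> the mean is differentiable; at \<open>y = 0\<close> it is
  squeezed between \<open>\<alpha> (t - y)\<close> and \<open>\<alpha> (t + y)\<close>.\<close>

lemma mean_continuous: "continuous_on {p. snd p \<ge> 0} (\<lambda>p. mean (fst p) (snd p))"
  unfolding continuous_on_eq_continuous_within
proof
  fix p :: "real \<times> real" assume p: "p \<in> {p. snd p \<ge> 0}"
  show "continuous (at p within {p. snd p \<ge> 0}) (\<lambda>p. mean (fst p) (snd p))"
  proof (cases "snd p = 0")
    case True
    have ev: "\<forall>\<^sub>F q in at p within {p. snd p \<ge> 0}. snd q \<ge> 0"
      by (simp add: eventually_at_filter)
    have c: "isCont \<alpha> x" for x using cont by (simp add: continuous_on_eq_continuous_at)
    have "((\<lambda>p. mean (fst p) (snd p)) \<longlongrightarrow> \<alpha> (fst p)) (at p within {p. snd p \<ge> 0})"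
    proof (rule tendsto_sandwich)
      show "\<forall>\<^sub>F q in at p within {p. snd p \<ge> 0}. \<alpha> (fst q - snd q) \<le> mean (fst q) (snd q)"
        "\<forall>\<^sub>F q in at p within {p. snd p \<ge> 0}. mean (fst q) (snd q) \<le> \<alpha> (fst q + snd q)"
        using ev by (eventually_elim; simp add: mean_bounds)+
      show "((\<lambda>q. \<alpha> (fst q - snd q)) \<longlongrightarrow> \<alpha> (fst p)) (at p within {p. snd p \<ge> 0})"
        by (rule isCont_tendsto_compose[OF c]) (use True in \<open>auto intro!: tendsto_eq_intros\<close>)
      show "((\<lambda>q. \<alpha> (fst q + snd q)) \<longlongrightarrow> \<alpha> (fst p)) (at p within {p. snd p \<ge> 0})"
        by (rule isCont_tendsto_compose[OF c]) (use True in \<open>auto intro!: tendsto_eq_intros\<close>)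
    qed
    then show ?thesis using True by (simp add: continuous_within mean_def)
  next
    case False
    then have "snd p > 0" using p by auto
    then have "isCont (\<lambda>p. mean (fst p) (snd p)) p"
      using has_derivative_continuous[OF mean_has_derivative[of "snd p" "fst p"]] by simp
    then show ?thesis by (rule continuous_at_imp_continuous_at_within)
  qed
qed

section \<open>Bijectivity of the mean in the angular variable\<close>

lemma mean_strict_mono:
  assumes "y \<ge> 0" "s < t" shows "mean s y < mean t y"
proof (cases "y = 0")
  case True
  then show ?thesis using expand[of s t] assms by (simp add: mean_def)
next
  case False
  then have y: "y > 0" using assms by simp
  have "((\<lambda>t. mean t y) has_real_derivative slope t y) (at t)" for t
  proof -
    have "((\<lambda>t. mean (fst (t, y)) (snd (t, y))) has_derivative (\<lambda>a. (\<lambda>(a, b). slope t y * a + mean_dy t y * b) (a, 0))) (at t)"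
      by (rule has_derivative_compose[where f = "\<lambda>t. (t, y)" and g = "\<lambda>p. mean (fst p) (snd p)"])
        (auto intro!: derivative_eq_intros mean_has_derivative[OF y, of t])
    then show ?thesis by (simp add: has_field_derivative_def)
  qed
  moreover have "slope t y > 0" for t using slope_ge[OF y, of t] by linarith
  ultimately show ?thesis
    by (intro DERIV_pos_imp_increasing[OF assms(2)]) blast
qed

lemma mean_surj:
  assumes "y \<ge> 0" obtains t where "mean t y = u"
proof -
  have cm: "continuous_on UNIV (\<lambda>t. mean t y)"
  proof -
    have "continuous_on UNIV (\<lambda>t. (t, y))" by (intro continuous_intros)
    from continuous_on_compose2[OF mean_continuous this] show ?thesis using assms by (simp add: image_subset_iff)
  qed
  \<comment> \<open>Since \<open>2 * pi > 1\<close>, moving \<open>k\<close> periods in either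
    direction carries the mean at least as far as \<open>u\<close>.\<close>
  obtain k :: nat where k: "\<bar>u\<bar> + \<bar>mean 0 y\<bar> \<le> of_nat k" using real_arch_simple by blast
  have kk: "of_nat k \<le> 2 * pi * of_nat k" using pi_gt3 by (simp add: mult_le_cancel_right1)
  have "mean (2 * pi * of_int (- int k)) y \<le> u" "u \<le> mean (2 * pi * of_int (int k)) y"
    using mean_shift[of 0 "- int k" y] mean_shift[of 0 "int k" y] k kk by auto
  moreover have "2 * pi * of_int (- int k) \<le> 2 * pi * of_int (int k)" by simp
  ultimately have "\<exists>t\<ge>2 * pi * of_int (- int k). t \<le> 2 * pi * of_int (int k) \<and> mean t y = u"
    by (intro IVT' continuous_on_subset[OF cm]) auto
  then show ?thesis using that by blast
qed

end

section \<open>The extension to the disk\<close>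

context expanding_lift
begin

text \<open>The half plane \<open>Re w \<le> 0\<close> covers the punctured closed disk through
  \<open>exp\<close>. With \<open>w = - y + \<i> t\<close> the averaging width \<open>y\<close> is
  \<open>- Re w\<close>, which vanishes on the unit circle.\<close>

definition log_ext :: "complex \<Rightarrow> complex" where
  "log_ext w = Complex (Re w) (mean (Im w) (- Re w))"

definition ext :: "complex \<Rightarrow> complex" where
  "ext z = (if z = 0 then 0 else exp (log_ext (Ln z)))"

text \<open>In logarithmic coordinates this is the derivative of the mean in \<open>t\<close>;
  \<open>4 * dil\<close> will bound the derivative of \<open>ext\<close>. The default 0 at the
  origin suits the condition \<open>\<mu> 0 = 0\<close> of \<open>orlicz_sobolevI\<close>.\<close>

definition dil :: "complex \<Rightarrow> real" where
  "dil z = (if z = 0 then 0 else slope (Im (Ln z)) (- Re (Ln z)))"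

lemma log_ext_shift:
  "log_ext (w + (of_int (2 * n) * pi) * \<i>) = log_ext w + (of_int (2 * n) * pi) * \<i>"
  using mean_shift[of "Im w" n "- Re w"] by (simp add: log_ext_def complex_eq_iff algebra_simps)

text \<open>Two logarithms of a point differ by a multiple of \<open>2 * pi * \<i>\<close>, and
  \<open>log_ext\<close> commutes with such shifts; thus the branch cut of \<open>Ln\<close> leaves
  no trace in \<open>ext\<close>.\<close>

lemma ext_exp: "ext (exp w) = exp (log_ext w)"
proof -
  have "exp (Ln (exp w)) = exp w" by simp
  then obtain n where "Ln (exp w) = w + (of_int (2 * n) * pi) * \<i>" using exp_eq by blast
  then have "log_ext (Ln (exp w)) = log_ext w + (of_int (2 * n) * pi) * \<i>" using log_ext_shift by simp
  then have "exp (log_ext (Ln (exp w))) = exp (log_ext w)" using exp_eq by blast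
  then show ?thesis by (simp add: ext_def)
qed

lemma dil_exp: "dil (exp w) = slope (Im w) (- Re w)"
proof -
  have "exp (Ln (exp w)) = exp w" by simp
  then obtain n where n: "Ln (exp w) = w + (of_int (2 * n) * pi) * \<i>" using exp_eq by blast
  have "slope (Im w + 2 * pi * of_int n) y = slope (Im w) y" for y
    using shift_of_int[of "Im w + y" n] shift_of_int[of "Im w - y" n] by (simp add: slope_def algebra_simps)
  then show ?thesis using n by (simp add: dil_def algebra_simps)
qed

lemma norm_ext [simp]: "cmod (ext z) = cmod z"
  by (simp add: ext_def log_ext_def)

lemma ext_cis: "ext (cis t) = cis (\<alpha> t)"
  using ext_exp[of "\<i> * t"] by (simp add: log_ext_def mean_def cis_conv_exp Complex_eq)

lemma exists_log:
  fixes z :: complex assumes "z \<noteq> 0" "cmod z \<le> 1" obtains w where "z = exp w" "Re w \<le> 0"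
  using assms that[of "Ln z"] by simp

text \<open>Moduli are preserved, so the logarithms have equal real parts. After one is moved by a
  multiple of \<open>2 * pi * \<i>\<close>, strict monotonicity of the mean makes them
  equal.\<close>

lemma inj_on_ext: "inj_on ext (cball 0 1)"
proof (rule inj_onI)
  fix z1 z2 assume z: "z1 \<in> cball 0 1" "z2 \<in> cball 0 1" and eq: "ext z1 = ext z2"
  then have "cmod z1 = cmod z2" by (metis norm_ext)
  show "z1 = z2"
  proof (cases "z1 = 0")
    case True
    then show ?thesis using \<open>cmod z1 = cmod z2\<close> by simp
  next
    case False
    then have "z2 \<noteq> 0" using \<open>cmod z1 = cmod z2\<close> by auto
    obtain w1 w2 where w: "z1 = exp w1" "Re w1 \<le> 0" "z2 = exp w2" "Re w2 \<le> 0"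
      using exists_log[of z1] exists_log[of z2] z False \<open>z2 \<noteq> 0\<close> by (metis mem_cball_0)
    then obtain n where "log_ext w1 = log_ext w2 + (of_int (2 * n) * pi) * \<i>"
      using eq exp_eq by (auto simp: ext_exp)
    then have l: "log_ext w1 = log_ext (w2 + (of_int (2 * n) * pi) * \<i>)" by (simp only: log_ext_shift)
    define v where "v = w2 + (of_int (2 * n) * pi) * \<i>"
    have "Re w1 = Re v" "mean (Im w1) (- Re w1) = mean (Im v) (- Re w1)"
      using l[folded v_def] by (auto simp: log_ext_def)
    then have "w1 = v"
      using mean_strict_mono[of "- Re w1" "Im w1" "Im v"] mean_strict_mono[of "- Re w1" "Im v" "Im w1"] w
      by (cases "Im w1" "Im v" rule: linorder_cases) (auto simp: complex_eq_iff)
    then show ?thesis unfolding w v_def using exp_eq by blast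
  qed
qed

lemma ext_image: "ext ` cball 0 1 = cball 0 1"
proof
  show "cball 0 1 \<subseteq> ext ` cball 0 1"
  proof
    fix u :: complex assume u: "u \<in> cball 0 1"
    show "u \<in> ext ` cball 0 1"
    proof (cases "u = 0")
      case True
      then show ?thesis by (intro image_eqI[of _ _ 0]) (auto simp: ext_def)
    next
      case False
      then obtain w where w: "u = exp w" "Re w \<le> 0" using exists_log u by (metis mem_cball_0)
      then obtain t where t: "mean t (- Re w) = Im w" using mean_surj[of "- Re w" "Im w"] by auto
      then have "ext (exp (Complex (Re w) t)) = u"
        unfolding ext_exp w by (simp add: log_ext_def)
      then show ?thesis using u by (metis image_eqI mem_cball_0 norm_ext)
    qed
  qed
qed auto

text \<open>A branch of the logarithm that is holomorphic near \<open>z0\<close> even on the cut of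
  \<open>Ln\<close>, because \<open>z / z0\<close> stays near 1.\<close>

definition local_log :: "complex \<Rightarrow> complex \<Rightarrow> complex" where
  "local_log z0 z = Ln z0 + Ln (z / z0)"

lemma local_log:
  assumes "z0 \<noteq> 0"
  shows "z \<noteq> 0 \<Longrightarrow> exp (local_log z0 z) = z"
    and "(local_log z0 has_field_derivative 1 / z0) (at z0)"
    and "local_log z0 z0 = Ln z0"
proof -
  show "z \<noteq> 0 \<Longrightarrow> exp (local_log z0 z) = z" using assms by (simp add: local_log_def exp_add)
  show "local_log z0 z0 = Ln z0" using assms by (simp add: local_log_def)
  show "(local_log z0 has_field_derivative 1 / z0) (at z0)"
    unfolding local_log_def using assms by (auto intro!: derivative_eq_intros)
qed

lemma ext_local: "z0 \<noteq> 0 \<Longrightarrow> z \<noteq> 0 \<Longrightarrow> ext z = exp (log_ext (local_log z0 z))"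
  by (metis ext_exp local_log(1))

lemma continuous_on_log_ext: "continuous_on {w. Re w \<le> 0} log_ext"
proof -
  have "continuous_on {w. Re w \<le> 0} (\<lambda>w. (Im w, - Re w))" by (intro continuous_intros)
  from continuous_on_compose2[OF mean_continuous this]
  have "continuous_on {w. Re w \<le> 0} (\<lambda>w. mean (Im w) (- Re w))" by (simp add: image_subset_iff)
  then show ?thesis unfolding log_ext_def Complex_eq by (intro continuous_intros)
qed

text \<open>At the origin continuity follows from preservation of the modulus; elsewhere
  \<open>ext\<close> factors through a local logarithm with values in the closed left half
  plane.\<close>

lemma continuous_on_ext: "continuous_on (cball 0 1) ext"
  unfolding continuous_on_eq_continuous_within
proof
  fix z0 :: complex assume z0: "z0 \<in> cball 0 1"
  show "continuous (at z0 within cball 0 1) ext"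
  proof (cases "z0 = 0")
    case True
    have "((\<lambda>z. cmod (ext z)) \<longlongrightarrow> 0) (at 0 within cball 0 1)"
      unfolding norm_ext by (rule tendsto_eq_rhs[OF tendsto_norm[OF tendsto_ident_at]]) simp
    then have "(ext \<longlongrightarrow> 0) (at 0 within cball 0 1)" by (simp only: tendsto_norm_zero_iff)
    then show ?thesis using True by (simp add: continuous_within ext_def)
  next
    case False
    define S where "S = cball 0 1 - {0::complex}"
    have "isCont (local_log z0) z0" using local_log(2)[OF False] by (rule DERIV_isCont)
    then have c1: "continuous (at z0 within S) (local_log z0)" by (rule continuous_at_imp_continuous_at_within)
    have im: "local_log z0 ` S \<subseteq> {w. Re w \<le> 0}"
    proof
      fix w assume "w \<in> local_log z0 ` S"
      then obtain z where "z \<in> S" "w = local_log z0 z" by auto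
      then have "exp w \<in> S" using local_log(1)[OF False, of z] by (auto simp: S_def)
      then show "w \<in> {w. Re w \<le> 0}" by (simp add: S_def)
    qed
    have "z0 \<in> S" using z0 False by (simp add: S_def)
    then have "continuous (at (local_log z0 z0) within local_log z0 ` S) log_ext"
      using continuous_on_subset[OF continuous_on_log_ext im] by (auto simp: continuous_on_eq_continuous_within)
    then have "continuous (at z0 within S) (\<lambda>z. exp (log_ext (local_log z0 z)))"
      by (intro continuous_within_compose2[OF c1, of "\<lambda>w. exp (log_ext w)"] continuous_intros)
    then have "((\<lambda>z. exp (log_ext (local_log z0 z))) \<longlongrightarrow> ext z0) (at z0 within S)"
      using ext_local[OF False False] by (simp add: continuous_within)
    moreover have "\<forall>\<^sub>F z in at z0 within S. exp (log_ext (local_log z0 z)) = ext z"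
      using ext_local[OF False] by (auto simp: eventually_at_filter S_def)
    ultimately have "(ext \<longlongrightarrow> ext z0) (at z0 within S)" using tendsto_cong by fast
    moreover have "at z0 within S = at z0 within cball 0 1"
      by (rule at_within_nhd[of _ "- {0}"]) (use False in \<open>auto simp: S_def\<close>)
    ultimately show ?thesis by (simp add: continuous_within)
  qed
qed

lemma homeomorphism_ext:
  obtains g where "homeomorphism (cball 0 1) (cball 0 1) ext g"
  using homeomorphism_compact[OF compact_cball continuous_on_ext ext_image inj_on_ext] by blast

section \<open>Derivatives of the extension and of its inverse\<close>

definition log_deriv :: "complex \<Rightarrow> complex \<Rightarrow> complex" where
  "log_deriv w h = Complex (Re h) (slope (Im w) (- Re w) * Im h - mean_dy (Im w) (- Re w) * Re h)"

definition log_deriv_inv :: "complex \<Rightarrow> complex \<Rightarrow> complex" where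
  "log_deriv_inv w h = Complex (Re h) ((Im h + mean_dy (Im w) (- Re w) * Re h) / slope (Im w) (- Re w))"

text \<open>The chain rule is applied with \<open>y = - Re w\<close>, whence the minus sign before
  \<open>mean_dy\<close>.\<close>

lemma log_ext_has_derivative:
  assumes "Re w < 0" shows "(log_ext has_derivative log_deriv w) (at w)"
proof -
  have "((\<lambda>w. (Im w, - Re w)) has_derivative (\<lambda>h. (Im h, - Re h))) (at w)"
    by (auto intro!: derivative_eq_intros)
  from has_derivative_compose[OF this mean_has_derivative] assms
  have "((\<lambda>w. mean (Im w) (- Re w)) has_derivative
      (\<lambda>h. slope (Im w) (- Re w) * Im h - mean_dy (Im w) (- Re w) * Re h)) (at w)" by simp
  then have "((\<lambda>w. complex_of_real (Re w) + \<i> * complex_of_real (mean (Im w) (- Re w))) has_derivative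
      (\<lambda>h. complex_of_real (Re h) + \<i> * complex_of_real (slope (Im w) (- Re w) * Im h - mean_dy (Im w) (- Re w) * Re h))) (at w)"
    by (intro derivative_intros)
  then show ?thesis unfolding log_ext_def log_deriv_def Complex_eq .
qed

text \<open>The triangular matrix has the entries 1, \<open>slope\<close> and
  \<open>- mean_dy\<close>; the last is dominated by \<open>slope\<close>, and
  \<open>1 \<le> 2 * slope\<close> absorbs the first.\<close>

lemma log_deriv_bound:
  assumes "Re w < 0" shows "cmod (log_deriv w h) \<le> 4 * slope (Im w) (- Re w) * cmod h"
proof -
  define s m where "s = slope (Im w) (- Re w)" and "m = mean_dy (Im w) (- Re w)"
  have s: "s \<ge> 1/2" "\<bar>m\<bar> \<le> s" using assms slope_ge mean_dy_bound by (auto simp: s_def m_def)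
  have "cmod (log_deriv w h) \<le> \<bar>Re h\<bar> + \<bar>s * Im h - m * Re h\<bar>"
    using cmod_le[of "log_deriv w h"] by (simp add: log_deriv_def s_def m_def)
  also have "\<dots> \<le> \<bar>Re h\<bar> + (s * \<bar>Im h\<bar> + s * \<bar>Re h\<bar>)"
  proof -
    have "\<bar>m * Re h\<bar> \<le> s * \<bar>Re h\<bar>" using s by (simp add: abs_mult mult_right_mono)
    moreover have "\<bar>s * Im h\<bar> = s * \<bar>Im h\<bar>" using s by (simp add: abs_mult)
    ultimately show ?thesis using abs_triangle_ineq4[of "s * Im h" "m * Re h"] by linarith
  qed
  also have "\<dots> \<le> cmod h + (s * cmod h + s * cmod h)"
    using s abs_Re_le_cmod[of h] abs_Im_le_cmod[of h] by (intro add_mono mult_left_mono) auto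
  also have "\<dots> \<le> 4 * s * cmod h"
    using mult_right_mono[of 1 "2 * s" "cmod h"] s by simp
  finally show ?thesis by (simp add: s_def)
qed

text \<open>Division by \<open>slope\<close> leaves entries of absolute value at most 2 and 1, so
  the bound does not depend on \<open>\<alpha>\<close>.\<close>

lemma log_deriv_inv_bound:
  assumes "Re w < 0" shows "cmod (log_deriv_inv w h) \<le> 4 * cmod h"
proof -
  define s m where "s = slope (Im w) (- Re w)" and "m = mean_dy (Im w) (- Re w)"
  have s: "s \<ge> 1/2" "\<bar>m\<bar> \<le> s" using assms slope_ge mean_dy_bound by (auto simp: s_def m_def)
  have "cmod (log_deriv_inv w h) \<le> \<bar>Re h\<bar> + \<bar>(Im h + m * Re h) / s\<bar>"
    using cmod_le[of "log_deriv_inv w h"] by (simp add: log_deriv_inv_def s_def m_def)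
  also have "\<bar>(Im h + m * Re h) / s\<bar> \<le> 2 * \<bar>Im h\<bar> + \<bar>Re h\<bar>"
  proof -
    have "\<bar>m * Re h\<bar> \<le> s * \<bar>Re h\<bar>" using s by (simp add: abs_mult mult_right_mono)
    moreover have "\<bar>Im h\<bar> \<le> 2 * s * \<bar>Im h\<bar>" using s by (simp add: mult_le_cancel_right1)
    ultimately have "\<bar>Im h + m * Re h\<bar> \<le> s * (2 * \<bar>Im h\<bar> + \<bar>Re h\<bar>)"
      using abs_triangle_ineq[of "Im h" "m * Re h"] by (simp add: algebra_simps)
    then show ?thesis using s by (simp add: abs_divide divide_le_eq mult.commute)
  qed
  finally show ?thesis using abs_Re_le_cmod[of h] abs_Im_le_cmod[of h] by linarith
qed

lemma log_deriv_inverse: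
  assumes "Re w < 0" shows "log_deriv w (log_deriv_inv w h) = h"
  using slope_ge[of "- Re w" "Im w"] assms by (simp add: log_deriv_def log_deriv_inv_def complex_eq_iff)

lemma ext_has_derivative:
  assumes "z \<in> ball 0 1 - {0}"
  shows "(ext has_derivative (\<lambda>h. ext z * log_deriv (Ln z) (h / z))) (at z)"
proof -
  have z: "z \<noteq> 0" "Re (Ln z) < 0" using assms by auto
  have "(local_log z has_derivative (\<lambda>h. h / z)) (at z)"
    using local_log(2)[OF z(1)] by (simp add: has_field_derivative_def mult.commute[of _ "inverse z"] divide_inverse_commute)
  moreover have "(log_ext has_derivative log_deriv (Ln z)) (at (local_log z z))"
    unfolding local_log(3)[OF z(1)] by (rule log_ext_has_derivative) fact
  ultimately have "((\<lambda>x. log_ext (local_log z x)) has_derivative (\<lambda>h. log_deriv (Ln z) (h / z))) (at z)"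
    by (rule has_derivative_compose)
  moreover have "(exp has_derivative (\<lambda>h. exp u * h)) (at u)" for u :: complex
    using DERIV_exp[of u] by (simp add: has_field_derivative_def)
  ultimately have "((\<lambda>x. exp (log_ext (local_log z x))) has_derivative
      (\<lambda>h. exp (log_ext (local_log z z)) * log_deriv (Ln z) (h / z))) (at z)"
    by (rule has_derivative_compose)
  then have "((\<lambda>x. exp (log_ext (local_log z x))) has_derivative (\<lambda>h. ext z * log_deriv (Ln z) (h / z))) (at z)"
    by (simp only: ext_local[OF z(1) z(1)])
  moreover have "open (- {0::complex})" by (intro open_Compl closed_singleton)
  ultimately show ?thesis
    by (rule has_derivative_transform_within_open) (use z ext_local[OF z(1)] in auto)
qed

text \<open>The factors \<open>ext z\<close> and \<open>1 / z\<close> from \<open>exp\<close> and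
  the logarithm have moduli with product 1, so the logarithmic bound carries over.\<close>

lemma ext_derivative_bound:
  assumes "z \<in> ball 0 1 - {0}"
  shows "cmod (ext z * log_deriv (Ln z) (h / z)) \<le> 4 * dil z * cmod h"
proof -
  have z: "z \<noteq> 0" "Re (Ln z) < 0" using assms by auto
  have "cmod (log_deriv (Ln z) (h / z)) \<le> 4 * dil z * (cmod h / cmod z)"
    using log_deriv_bound[OF z(2), of "h / z"] z(1) by (simp add: dil_def norm_divide)
  then have "cmod z * cmod (log_deriv (Ln z) (h / z)) \<le> cmod z * (4 * dil z * (cmod h / cmod z))"
    by (rule mult_left_mono) simp
  then show ?thesis using z by (simp add: norm_mult)
qed

text \<open>The inverse function theorem is used in its pointwise form: \<open>ext\<close> is
  continuous with known inverse \<open>g\<close>, and its derivative at \<open>z\<close> has an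
  explicit right inverse. The moduli cancel again, leaving the constant 4.\<close>

lemma ext_inverse_has_derivative:
  assumes g: "homeomorphism (cball 0 1) (cball 0 1) ext g" and u: "u \<in> ball 0 1 - {0}"
  obtains D where "(g has_derivative D) (at u)" "\<And>h. cmod (D h) \<le> 4 * cmod h"
proof -
  define z where "z = g u"
  have uz: "ext z = u" and gz: "\<And>z. z \<in> cball 0 1 \<Longrightarrow> g (ext z) = z"
    using g u by (auto simp: homeomorphism_def z_def)
  then have zu: "cmod z = cmod u" by (metis norm_ext)
  then have z: "z \<in> ball 0 1 - {0}" using u by auto
  have Re: "Re (Ln z) < 0" using z by auto
  let ?D = "\<lambda>h. z * log_deriv_inv (Ln z) (h / u)"
  have "(g has_derivative ?D) (at (ext z))"
  proof (rule has_derivative_inverse_strong[OF open_ball _ _ _ ext_has_derivative[OF z]])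
    show "z \<in> ball 0 1" using z by auto
    show "continuous_on (ball 0 1) ext" by (rule continuous_on_subset[OF continuous_on_ext]) auto
    show "\<And>x. x \<in> ball 0 1 \<Longrightarrow> g (ext x) = x" using gz by auto
    show "(\<lambda>h. ext z * log_deriv (Ln z) (h / z)) \<circ> ?D = id"
      using z u uz by (auto simp: fun_eq_iff log_deriv_inverse[OF Re])
  qed
  moreover have "cmod (?D h) \<le> 4 * cmod h" for h
  proof -
    have "cmod z * cmod (log_deriv_inv (Ln z) (h / u)) \<le> cmod z * (4 * cmod (h / u))"
      by (rule mult_left_mono[OF log_deriv_inv_bound[OF Re]]) simp
    then show ?thesis using u zu by (simp add: norm_mult norm_divide)
  qed
  ultimately show ?thesis using that uz by blast
qed

end

section \<open>The energy estimate\<close>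

lemma convex_scale_le:
  fixes \<Phi> :: "real \<Rightarrow> real"
  assumes "convex_on {0..} \<Phi>" "\<Phi> 0 = 0" "0 \<le> l" "l \<le> 1" "0 \<le> t"
  shows "\<Phi> (l * t) \<le> l * \<Phi> t"
  using convex_onD[OF assms(1), of l 0 t] assms by simp

lemma ex_dyadic_power:
  fixes x :: real assumes "x \<ge> 1" obtains n where "2 ^ n \<le> x" "x < 2 ^ Suc n"
proof -
  define m where "m = (LEAST m. x < 2 ^ m)"
  have "\<exists>m. x < 2 ^ m" using real_arch_pow[of 2 x] by simp
  then have m: "x < 2 ^ m" unfolding m_def by (rule LeastI_ex)
  then have "m \<noteq> 0" using assms by (intro notI) simp
  then obtain n where n: "m = Suc n" by (cases m) auto
  then have "\<not> x < 2 ^ n" using not_less_Least[of n "\<lambda>m. x < 2 ^ m"] by (simp add: m_def)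
  then show ?thesis using that[of n] m n by simp
qed

text \<open>Comparison with the integral over the disjoint intervals from \<open>a n\<close> to
  \<open>2 * a n\<close>, where \<open>a n = c * 2 ^ n \<ge> 1\<close>. There the integrand is at
  least \<open>\<Phi> (a n) / (2 * a n) ^ 3\<close>, and multiplying by the length
  \<open>a n\<close> gives a fixed multiple of the \<open>n\<close>-th term.\<close>

lemma dyadic_sum_finite:
  fixes \<Phi> :: "real \<Rightarrow> real"
  assumes nonneg: "\<And>t. t \<ge> 0 \<Longrightarrow> \<Phi> t \<ge> 0" and mono: "mono_on {0..} \<Phi>"
    and int: "(\<integral>\<^sup>+t\<in>{1..}. ennreal (\<Phi> t / t ^ 3) \<partial>lborel) < \<infinity>" and c: "c \<ge> 1"
  shows "(\<Sum>n. ennreal (\<Phi> (c * 2 ^ n) / 4 ^ n)) < \<infinity>"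
proof -
  define a where "a n = c * 2 ^ n" for n :: nat
  have a: "a n \<ge> 1" for n using c mult_mono[of 1 c 1 "2 ^ n"] by (simp add: a_def)
  define b where "b n = ennreal (\<Phi> (a n) / (2 * a n) ^ 3)" for n
  have "(\<Sum>n. ennreal (\<Phi> (c * 2 ^ n) / 4 ^ n)) = (\<Sum>n. ennreal (8 * c ^ 2) * (b n * emeasure lborel {a n..<2 * a n}))"
  proof (rule suminf_cong)
    fix n
    have "emeasure lborel {a n..<2 * a n} = ennreal (a n)" using a[of n] by simp
    moreover have "\<Phi> (c * 2 ^ n) / 4 ^ n = 8 * c ^ 2 * (\<Phi> (a n) / (2 * a n) ^ 3 * a n)"
    proof -
      have "(4::real) ^ n = 2 ^ n * 2 ^ n" by (simp add: power_mult_distrib[symmetric])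
      then show ?thesis using c by (simp add: a_def power2_eq_square power3_eq_cube field_simps)
    qed
    moreover have "0 \<le> \<Phi> (a n) / (2 * a n) ^ 3" "0 \<le> a n" using a[of n] nonneg[of "a n"] by simp_all
    ultimately show "ennreal (\<Phi> (c * 2 ^ n) / 4 ^ n) = ennreal (8 * c ^ 2) * (b n * emeasure lborel {a n..<2 * a n})"
      unfolding b_def by (simp only: ennreal_mult mult_nonneg_nonneg zero_le_power2 zero_le_mult_iff zero_le_numeral simp_thms)
  qed
  also have "\<dots> = ennreal (8 * c ^ 2) * (\<Sum>n. b n * emeasure lborel {a n..<2 * a n})"
    by (rule ennreal_suminf_cmult)
  also have "(\<Sum>n. b n * emeasure lborel {a n..<2 * a n}) = (\<Sum>n. \<integral>\<^sup>+t. b n * indicator {a n..<2 * a n} t \<partial>lborel)"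
    by (intro suminf_cong) (simp add: nn_integral_cmult_indicator)
  also have "\<dots> = (\<integral>\<^sup>+t. (\<Sum>n. b n * indicator {a n..<2 * a n} t) \<partial>lborel)"
    by (rule nn_integral_suminf[symmetric]) simp
  also have "\<dots> \<le> (\<integral>\<^sup>+t\<in>{1..}. ennreal (\<Phi> t / t ^ 3) \<partial>lborel)"
  proof (rule nn_integral_mono)
    fix t :: real
    show "(\<Sum>n. b n * indicator {a n..<2 * a n} t) \<le> ennreal (\<Phi> t / t ^ 3) * indicator {1..} t"
    proof (cases "\<exists>m. t \<in> {a m..<2 * a m}")
      case True
      then obtain m where m: "a m \<le> t" "t < 2 * a m" by auto
      have "t \<notin> {a n..<2 * a n}" if "n \<noteq> m" for n
      \<comment> \<open>Since \<open>2 * a n = a (Suc n)\<close>, consecutive half-open intervals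
        abut without overlap.\<close>
      proof (cases "n < m")
        case True
        then have "c * 2 ^ Suc n \<le> c * 2 ^ m" using c by (intro mult_left_mono power_increasing) auto
        then show ?thesis using m by (auto simp: a_def)
      next
        case False
        then have "c * 2 ^ Suc m \<le> c * 2 ^ n" using c that by (intro mult_left_mono power_increasing) auto
        then show ?thesis using m by (auto simp: a_def)
      qed
      then have "(\<Sum>n. b n * indicator {a n..<2 * a n} t) = (\<Sum>n\<in>{m}. b n * indicator {a n..<2 * a n} t)"
        by (intro suminf_finite) auto
      also have "\<dots> = b m" using m by simp
      also have "b m \<le> ennreal (\<Phi> t / t ^ 3)"
        unfolding b_def using m a[of m] nonneg[of "a m"] mono_onD[OF mono, of "a m" t]
        by (intro ennreal_leI frac_le power_mono) auto
      finally show ?thesis using m a[of m] by simp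
    qed auto
  qed
  also have "ennreal (8 * c ^ 2) * \<dots> < \<infinity>"
    using int by (simp add: ennreal_mult_less_top)
  finally show ?thesis by (simp add: mult_left_mono)
qed

section \<open>Dilatation on dyadic tiles\<close>

context expanding_lift
begin

text \<open>At most \<open>(b - a) / (2 * pi) + 1\<close> whole periods cover the interval, and each
  adds exactly \<open>2 * pi\<close>.\<close>

lemma increment_le:
  assumes "a \<le> b" shows "\<alpha> b - \<alpha> a \<le> b - a + 2 * pi"
proof -
  define k where "k = \<lceil>(b - a) / (2 * pi)\<rceil>"
  have k: "b - a \<le> 2 * pi * of_int k" "2 * pi * of_int k \<le> b - a + 2 * pi"
  proof -
    have "(b - a) / (2 * pi) \<le> of_int k" "of_int k \<le> (b - a) / (2 * pi) + 1"
      unfolding k_def by linarith+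
    then show "b - a \<le> 2 * pi * of_int k" "2 * pi * of_int k \<le> b - a + 2 * pi"
      using pi_gt_zero by (simp_all add: field_simps)
  qed
  have "\<alpha> b \<le> \<alpha> (a + 2 * pi * of_int k)" using k by (intro mono) simp
  then show ?thesis using k shift_of_int[of a k] by simp
qed

text \<open>Modulo the period, the intervals from \<open>(k - 1) * \<delta>\<close> to
  \<open>(k + 2) * \<delta>\<close> cover everything three times, so the total is three times
  \<open>2 * pi\<close>.\<close>

lemma sum_shifted_increments:
  assumes "real N * \<delta> = 2 * pi"
  shows "(\<Sum>k<N. \<alpha> ((real k + 2) * \<delta>) - \<alpha> ((real k - 1) * \<delta>)) = 6 * pi"
proof -
  \<comment> \<open>Three consecutive values of \<open>\<alpha>\<close>: in
    \<open>g (Suc k) - g k\<close> the two shared ones cancel.\<close>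
  define g where "g k = \<alpha> ((real k + 1) * \<delta>) + \<alpha> (real k * \<delta>) + \<alpha> ((real k - 1) * \<delta>)" for k
  have "(\<Sum>k<N. \<alpha> ((real k + 2) * \<delta>) - \<alpha> ((real k - 1) * \<delta>)) = (\<Sum>k<N. g (Suc k) - g k)"
    by (rule sum.cong) (auto simp: g_def algebra_simps)
  also have "\<dots> = g N - g 0" by (rule sum_lessThan_telescope)
  also have "\<dots> = 6 * pi"
    using assms shift[of \<delta>] shift[of 0] shift[of "- \<delta>"] by (simp add: g_def algebra_simps)
  finally show ?thesis .
qed

text \<open>Here \<open>y \<ge> 2 * pi\<close>, so an interval of length \<open>2 * y\<close> has
  increment at most \<open>2 * y + 2 * pi \<le> 4 * y\<close>.\<close>

lemma dil_le_inner:
  assumes "z \<in> ball 0 1" "cmod z \<le> exp (- 2 * pi)"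
  shows "0 \<le> dil z" "dil z \<le> 2"
proof -
  have "0 \<le> dil z \<and> dil z \<le> 2"
  proof (cases "z = 0")
    case True
    then show ?thesis by (simp add: dil_def)
  next
    case False
    define y where "y = - Re (Ln z)"
    have "exp (- y) \<le> exp (- 2 * pi)" using assms False by (simp add: y_def)
    then have y: "y \<ge> 2 * pi" by simp
    then have y0: "y > 0" using pi_gt_zero by linarith
    have "\<alpha> (Im (Ln z) + y) - \<alpha> (Im (Ln z) - y) \<le> 2 * (2 * y)"
      using increment_le[of "Im (Ln z) - y" "Im (Ln z) + y"] y y0 by simp
    then have "slope (Im (Ln z)) y \<le> 2" using y0 by (simp add: slope_def divide_le_eq)
    moreover have "dil z = slope (Im (Ln z)) y" using False by (simp only: dil_def y_def if_False)
    ultimately show ?thesis using slope_ge[OF y0, of "Im (Ln z)"] by simp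
  qed
  then show "0 \<le> dil z" "dil z \<le> 2" by auto
qed

text \<open>With \<open>\<delta> = 2 * pi / 2 ^ n\<close>, the level \<open>n\<close> is chosen so
  that \<open>y \<le> \<delta> < 2 * y\<close>, and \<open>k\<close> so that
  \<open>k * \<delta> \<le> t < (k + 1) * \<delta>\<close>. Then \<open>t - y\<close> and
  \<open>t + y\<close> stay between \<open>(k - 1) * \<delta>\<close> and
  \<open>(k + 2) * \<delta>\<close>, and \<open>\<delta>\<close> may replace \<open>2 * y\<close> in
  the denominator.\<close>

lemma dil_le_tile:
  assumes "z \<in> ball 0 1" "exp (- 2 * pi) < cmod z"
  obtains n k where "k < 2 ^ n" "z \<in> ball (cis (real k * (2 * pi / 2 ^ n))) (3 * (2 * pi / 2 ^ n))"
    "0 \<le> dil z"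
    "dil z \<le> (\<alpha> ((real k + 2) * (2 * pi / 2 ^ n)) - \<alpha> ((real k - 1) * (2 * pi / 2 ^ n))) / (2 * pi / 2 ^ n)"
proof -
  have z0: "z \<noteq> 0" using assms(2) by (metis exp_gt_zero norm_zero not_less_iff_gr_or_eq)
  \<comment> \<open>\<open>Arg2pi\<close> puts the angle into \<open>[0, 2 * pi)\<close>, so that
    \<open>k\<close> is a natural number below \<open>2 ^ n\<close>.\<close>
  define t y where "t = Arg2pi z" and "y = - ln (cmod z)"
  have t: "0 \<le> t" "t < 2 * pi" using Arg2pi[of z] by (auto simp: t_def)
  define w where "w = Complex (- y) t"
  have ew: "exp w = z"
  proof -
    have "exp w = of_real (exp (- y)) * exp (\<i> * of_real t)"
      by (simp add: w_def Complex_eq exp_add[symmetric] exp_of_real[symmetric] del: exp_of_real)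
    then show ?thesis using Arg2pi_eq[of z] z0 by (simp add: y_def t_def)
  qed
  have "exp (- y) < exp 0" "exp (- 2 * pi) < exp (- y)" using assms z0 by (simp_all add: y_def)
  then have y: "0 < y" "y < 2 * pi" unfolding exp_less_cancel_iff by auto
  have dil: "dil z = slope t y" using dil_exp[of w] unfolding ew by (simp add: w_def)
  have "1 \<le> 2 * pi / y" using y by simp
  then obtain n where n: "2 ^ n \<le> 2 * pi / y" "2 * pi / y < 2 ^ Suc n" by (rule ex_dyadic_power)
  define \<delta> where "\<delta> = 2 * pi / 2 ^ n"
  have \<delta>: "\<delta> > 0" by (simp add: \<delta>_def)
  have y\<delta>: "y \<le> \<delta>" "\<delta> < 2 * y" using n y by (simp_all add: \<delta>_def field_simps)
  define k where "k = nat \<lfloor>t / \<delta>\<rfloor>"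
  have k: "real k * \<delta> \<le> t" "t < (real k + 1) * \<delta>"
  proof -
    have "0 \<le> t / \<delta>" using t \<delta> by simp
    then have "real k \<le> t / \<delta>" "t / \<delta> < real k + 1" unfolding k_def by linarith+
    then show "real k * \<delta> \<le> t" "t < (real k + 1) * \<delta>" using \<delta> by (simp_all add: field_simps)
  qed
  have "real k < 2 ^ n"
  proof -
    have "real k * \<delta> < 2 ^ n * \<delta>" using k t by (simp add: \<delta>_def)
    then show ?thesis using \<delta> by simp
  qed
  then have "k < 2 ^ n" by (metis of_nat_less_iff of_nat_numeral of_nat_power)
  moreover have "z \<in> ball (cis (real k * \<delta>)) (3 * \<delta>)"
  proof -
    define w0 where "w0 = Complex 0 (real k * \<delta>)"
    \<comment> \<open>\<open>exp\<close> has derivative of modulus at most 1 on the closed left half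
      plane, so distances can be estimated in logarithmic coordinates.\<close>
    have "cmod (exp w - exp w0) \<le> 1 * cmod (w - w0)"
    proof (rule field_differentiable_bound[where S = "{w. Re w \<le> 0}" and f' = exp])
      show "convex {w. Re w \<le> 0}" by (rule convex_halfspace_Re_le)
    qed (use y in \<open>auto intro!: derivative_eq_intros simp: w_def w0_def\<close>)
    also have "cmod (w - w0) \<le> \<bar>y\<bar> + \<bar>t - real k * \<delta>\<bar>"
      using cmod_le[of "w - w0"] by (simp add: w_def w0_def)
    also have "\<dots> < 3 * \<delta>" using y y\<delta> k \<delta> by (simp add: algebra_simps)
    finally have "cmod (exp w - exp w0) < 3 * \<delta>" by simp
    moreover have "exp w0 = cis (real k * \<delta>)" by (simp add: w0_def cis_conv_exp Complex_eq mult.commute)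
    ultimately show ?thesis by (simp add: ew dist_norm norm_minus_commute)
  qed
  moreover have "0 \<le> dil z" using slope_ge[OF y(1), of t] dil by simp
  moreover have "dil z \<le> (\<alpha> ((real k + 2) * \<delta>) - \<alpha> ((real k - 1) * \<delta>)) / \<delta>"
  proof -
    have "\<alpha> (t + y) - \<alpha> (t - y) \<le> \<alpha> ((real k + 2) * \<delta>) - \<alpha> ((real k - 1) * \<delta>)"
      using y\<delta> k by (intro diff_mono mono) (simp_all add: algebra_simps)
    moreover have "0 \<le> \<alpha> (t + y) - \<alpha> (t - y)" using mono[of "t - y" "t + y"] y by simp
    ultimately show ?thesis
      unfolding dil slope_def using y\<delta> \<delta> by (intro frac_le) auto
  qed
  ultimately show ?thesis using that unfolding \<delta>_def by blast
qed

text \<open>Each tile of level \<open>n\<close> lies in a ball of area a constant times the square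
  of \<open>\<delta> n\<close>, and \<open>row\<close> bounds the sum of the values of
  \<open>\<Phi>\<close> over the level. Overlaps of the balls are harmless for an upper bound; what
  remains is the dyadic sum with \<open>c = 3 * C\<close>.\<close>

lemma dilatation_integral_finite:
  fixes \<Phi> :: "real \<Rightarrow> real"
  assumes nonneg: "\<And>t. t \<ge> 0 \<Longrightarrow> \<Phi> t \<ge> 0" and mono\<Phi>: "mono_on {0..} \<Phi>"
    and convex: "convex_on {0..} \<Phi>" and zero: "\<Phi> 0 = 0"
    and int: "(\<integral>\<^sup>+t\<in>{1..}. ennreal (\<Phi> t / t ^ 3) \<partial>lborel) < \<infinity>" and C: "C \<ge> 1"
  shows "(\<integral>\<^sup>+z\<in>ball 0 1. ennreal (\<Phi> (C * dil z)) \<partial>lebesgue) < \<infinity>"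
proof -
  define \<delta> where "\<delta> n = 2 * pi / 2 ^ n" for n :: nat
  define \<Delta> where "\<Delta> n k = \<alpha> ((real k + 2) * \<delta> n) - \<alpha> ((real k - 1) * \<delta> n)" for n and k :: nat
  define B where "B n k = (ball (cis (real k * \<delta> n)) (3 * \<delta> n) :: complex set)" for n and k :: nat
  define V where "V = unit_ball_vol 2"
  have \<delta>: "\<delta> n > 0" for n by (simp add: \<delta>_def)
  have \<Delta>: "0 \<le> \<Delta> n k" for n k unfolding \<Delta>_def using \<delta>[of n] by (simp add: mono)
  have N\<delta>: "real (2 ^ n) * \<delta> n = 2 * pi" for n by (simp add: \<delta>_def)
  have sum\<Delta>: "(\<Sum>k<2 ^ n. \<Delta> n k) = 6 * pi" for n
    unfolding \<Delta>_def by (rule sum_shifted_increments[OF N\<delta>])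
  have V: "V \<ge> 0" by (simp add: V_def)
  have vol: "emeasure lborel (B n k) = ennreal (V * (3 * \<delta> n)\<^sup>2)" for n k
    unfolding B_def V_def using \<delta>[of n] by (subst emeasure_ball) auto
  have [measurable]: "B n k \<in> sets borel" "ball (0::complex) 1 \<in> sets borel" for n k
    by (simp_all add: B_def)
  \<comment> \<open>The weights \<open>\<Delta> n k / (6 * pi)\<close> lie in \<open>[0, 1]\<close>
    and sum to 1. As \<open>6 * pi * C / \<delta> n = 3 * C * 2 ^ n\<close>, convexity with
    \<open>\<Phi> 0 = 0\<close> extracts each weight from \<open>\<Phi>\<close>.\<close>
  have row: "(\<Sum>k<2 ^ n. \<Phi> (C * \<Delta> n k / \<delta> n)) \<le> \<Phi> (3 * C * 2 ^ n)" for n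
  proof -
    have "\<Phi> (C * \<Delta> n k / \<delta> n) \<le> \<Delta> n k / (6 * pi) * \<Phi> (3 * C * 2 ^ n)" if "k < 2 ^ n" for k
    proof -
      have "\<Delta> n k \<le> 6 * pi"
        unfolding sum\<Delta>[of n, symmetric] using that \<Delta> by (intro member_le_sum) auto
      then have "\<Phi> (\<Delta> n k / (6 * pi) * (3 * C * 2 ^ n)) \<le> \<Delta> n k / (6 * pi) * \<Phi> (3 * C * 2 ^ n)"
        using C \<Delta>[of n k] by (intro convex_scale_le convex zero) auto
      moreover have "\<Delta> n k / (6 * pi) * (3 * C * 2 ^ n) = C * \<Delta> n k / \<delta> n"
        by (simp add: \<delta>_def field_simps)
      ultimately show ?thesis by simp
    qed
    then have "(\<Sum>k<2 ^ n. \<Phi> (C * \<Delta> n k / \<delta> n)) \<le> (\<Sum>k<2 ^ n. \<Delta> n k / (6 * pi) * \<Phi> (3 * C * 2 ^ n))"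
      by (intro sum_mono) auto
    also have "\<dots> = \<Phi> (3 * C * 2 ^ n)"
      by (simp add: sum_distrib_right[symmetric] sum_divide_distrib[symmetric] sum\<Delta>)
    finally show ?thesis .
  qed
  let ?T = "\<lambda>n z. \<Sum>k<2 ^ n. ennreal (\<Phi> (C * \<Delta> n k / \<delta> n)) * indicator (B n k) z"
  \<comment> \<open>The central disk of radius \<open>exp (- 2 * pi)\<close> is charged to the first
    summand, every other point of the disk to one term of the double sum.\<close>
  have pointwise: "ennreal (\<Phi> (C * dil z)) * indicator (ball 0 1) z \<le>
      ennreal (\<Phi> (2 * C)) * indicator (ball 0 1) z + (\<Sum>n. ?T n z)" for z :: complex
  proof (cases "z \<in> ball 0 1")
    case zb: True
    show ?thesis
    proof (cases "cmod z \<le> exp (- 2 * pi)")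
      case True
      then have "\<Phi> (C * dil z) \<le> \<Phi> (2 * C)"
        using dil_le_inner[OF zb] C by (intro mono_onD[OF mono\<Phi>]) auto
      then have "ennreal (\<Phi> (C * dil z)) * indicator (ball 0 1) z \<le> ennreal (\<Phi> (2 * C)) * indicator (ball 0 1) z"
        by (intro mult_right_mono ennreal_leI) auto
      also have "\<dots> \<le> \<dots> + (\<Sum>n. ?T n z)" by simp
      finally show ?thesis .
    next
      case False
      then obtain n k where nk: "k < 2 ^ n" "z \<in> B n k" "0 \<le> dil z" "dil z \<le> \<Delta> n k / \<delta> n"
        using dil_le_tile[OF zb] unfolding B_def \<Delta>_def \<delta>_def by (metis not_le)
      have "\<Phi> (C * dil z) \<le> \<Phi> (C * \<Delta> n k / \<delta> n)"
      proof (rule mono_onD[OF mono\<Phi>])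
        show "C * dil z \<le> C * \<Delta> n k / \<delta> n" using mult_left_mono[OF nk(4), of C] C by simp
        then show "C * \<Delta> n k / \<delta> n \<in> {0..}" using \<Delta>[of n k] \<delta>[of n] C by simp
      qed (use nk C in auto)
      then have "ennreal (\<Phi> (C * dil z)) * indicator (ball 0 1) z \<le> ennreal (\<Phi> (C * \<Delta> n k / \<delta> n)) * indicator (B n k) z"
        using zb nk by (simp add: ennreal_leI)
      also have "\<dots> \<le> ?T n z" by (rule member_le_sum) (use nk in auto)
      also have "\<dots> \<le> (\<Sum>n. ?T n z)"
        using sum_le_suminf[of "\<lambda>n. ?T n z" "{n}"] by simp
      also have "\<dots> \<le> ennreal (\<Phi> (2 * C)) * indicator (ball 0 1) z + (\<Sum>n. ?T n z)" by simp
      finally show ?thesis .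
    qed
  qed simp
  have "(\<integral>\<^sup>+z\<in>ball 0 1. ennreal (\<Phi> (C * dil z)) \<partial>lebesgue) = (\<integral>\<^sup>+z\<in>ball 0 1. ennreal (\<Phi> (C * dil z)) \<partial>lborel)"
    by (rule nn_integral_completion)
  also have "\<dots> \<le> (\<integral>\<^sup>+z. ennreal (\<Phi> (2 * C)) * indicator (ball 0 1) z + (\<Sum>n. ?T n z) \<partial>lborel)"
    by (rule nn_integral_mono) (rule pointwise)
  also have "\<dots> = (\<integral>\<^sup>+z. ennreal (\<Phi> (2 * C)) * indicator (ball (0::complex) 1) z \<partial>lborel) + (\<integral>\<^sup>+z. (\<Sum>n. ?T n z) \<partial>lborel)"
    by (rule nn_integral_add) measurable
  also have "(\<integral>\<^sup>+z. (\<Sum>n. ?T n z) \<partial>lborel) = (\<Sum>n. \<integral>\<^sup>+z. ?T n z \<partial>lborel)"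
    by (rule nn_integral_suminf) measurable
  also have "\<dots> \<le> (\<Sum>n. ennreal (V * 36 * pi\<^sup>2) * ennreal (\<Phi> (3 * C * 2 ^ n) / 4 ^ n))"
  proof (intro suminf_le allI)
    fix n
    have "(\<integral>\<^sup>+z. ?T n z \<partial>lborel) = (\<Sum>k<2 ^ n. \<integral>\<^sup>+z. ennreal (\<Phi> (C * \<Delta> n k / \<delta> n)) * indicator (B n k) z \<partial>lborel)"
      by (rule nn_integral_sum) measurable
    also have "\<dots> = (\<Sum>k<2 ^ n. ennreal (\<Phi> (C * \<Delta> n k / \<delta> n)) * ennreal (V * (3 * \<delta> n)\<^sup>2))"
      using vol by (intro sum.cong refl, subst nn_integral_cmult_indicator) (auto simp: B_def)
    also have "\<dots> = (\<Sum>k<2 ^ n. ennreal (\<Phi> (C * \<Delta> n k / \<delta> n))) * ennreal (V * (3 * \<delta> n)\<^sup>2)"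
      by (simp add: sum_distrib_right)
    also have "(\<Sum>k<2 ^ n. ennreal (\<Phi> (C * \<Delta> n k / \<delta> n))) = ennreal (\<Sum>k<2 ^ n. \<Phi> (C * \<Delta> n k / \<delta> n))"
      using \<Delta> \<delta> C by (intro sum_ennreal nonneg) (simp add: less_imp_le)
    also have "\<dots> * ennreal (V * (3 * \<delta> n)\<^sup>2) \<le> ennreal (\<Phi> (3 * C * 2 ^ n)) * ennreal (V * (3 * \<delta> n)\<^sup>2)"
      by (intro mult_right_mono ennreal_leI row) auto
    also have "\<dots> = ennreal (\<Phi> (3 * C * 2 ^ n) * (V * (3 * \<delta> n)\<^sup>2))"
      using C V by (intro ennreal_mult[symmetric] nonneg) auto
    also have "\<Phi> (3 * C * 2 ^ n) * (V * (3 * \<delta> n)\<^sup>2) = (V * 36 * pi\<^sup>2) * (\<Phi> (3 * C * 2 ^ n) / 4 ^ n)"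
    proof -
      have "(\<delta> n)\<^sup>2 = 4 * pi\<^sup>2 / 4 ^ n"
        by (simp add: \<delta>_def power_divide power_mult_distrib power_mult[symmetric] mult.commute[of n] power_mult)
      then show ?thesis by (simp add: power_mult_distrib)
    qed
    also have "ennreal \<dots> = ennreal (V * 36 * pi\<^sup>2) * ennreal (\<Phi> (3 * C * 2 ^ n) / 4 ^ n)"
      using C V by (intro ennreal_mult divide_nonneg_nonneg nonneg) auto
    finally show "(\<integral>\<^sup>+z. ?T n z \<partial>lborel) \<le> ennreal (V * 36 * pi\<^sup>2) * ennreal (\<Phi> (3 * C * 2 ^ n) / 4 ^ n)" .
  qed auto
  also have "\<dots> = ennreal (V * 36 * pi\<^sup>2) * (\<Sum>n. ennreal (\<Phi> (3 * C * 2 ^ n) / 4 ^ n))"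
    by (rule ennreal_suminf_cmult)
  also have "(\<integral>\<^sup>+z. ennreal (\<Phi> (2 * C)) * indicator (ball (0::complex) 1) z \<partial>lborel) = ennreal (\<Phi> (2 * C)) * ennreal V"
    by (subst nn_integral_cmult_indicator) (auto simp: emeasure_ball V_def)
  also have "ennreal (\<Phi> (2 * C)) * ennreal V + ennreal (V * 36 * pi\<^sup>2) * (\<Sum>n. ennreal (\<Phi> (3 * C * 2 ^ n) / 4 ^ n)) < \<infinity>"
    using dyadic_sum_finite[OF nonneg mono\<Phi> int, of "3 * C"] C by (simp add: ennreal_mult_less_top)
  finally show ?thesis by (simp add: add_left_mono)
qed

end

section \<open>Lifts of circle homeomorphisms\<close>

lemma cis_eq_iff: "cis s = cis t \<longleftrightarrow> (\<exists>k::int. s = t + 2 * pi * of_int k)"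
proof -
  have "cis s = cis t \<longleftrightarrow> exp (\<i> * of_real s) = exp (\<i> * of_real t)" by (simp add: cis_conv_exp)
  also have "\<dots> \<longleftrightarrow> (\<exists>k::int. s = t + 2 * pi * of_int k)"
    unfolding exp_eq by (intro ex_cong1) (auto simp: complex_eq_iff algebra_simps)
  finally show ?thesis .
qed

lemma shift_of_nat:
  fixes F :: "real \<Rightarrow> real"
  assumes "\<And>t. F (t + c) = F t + c"
  shows "F (t + c * real n) = F t + c * real n"
proof (induction n)
  case (Suc n)
  then show ?case using assms[of "t + c * real n"] by (simp add: algebra_simps)
qed simp

lemma surj_of_shift:
  fixes F :: "real \<Rightarrow> real"
  assumes cont: "continuous_on UNIV F" and shift: "\<And>t. F (t + c) = F t + c" and c: "c > 0"
  shows "surj F"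
proof -
  have "\<exists>t. F t = u" for u
  proof -
    obtain n :: nat where "\<bar>u - F 0\<bar> / c \<le> real n" using real_arch_simple by blast
    then have n: "\<bar>u - F 0\<bar> \<le> c * real n" using c by (simp add: field_simps)
    have "F (c * real n) = F 0 + c * real n" using shift_of_nat[of F c, OF shift, of 0 n] by simp
    moreover have "F 0 = F (- (c * real n)) + c * real n"
      using shift_of_nat[of F c, OF shift, of "- (c * real n)" n] by simp
    moreover have "- (c * real n) \<le> c * real n" using c by simp
    ultimately have "\<exists>t\<ge>- (c * real n). t \<le> c * real n \<and> F t = u"
      using n by (intro IVT' continuous_on_subset[OF cont]) auto
    then show ?thesis by blast
  qed
  then show ?thesis by (metis surjI)
qed

text \<open>The circle map has a continuous logarithm along the line; its imaginary part
  \<open>f\<close> gains a constant \<open>2 * pi * d\<close> per period, with \<open>d\<close> an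
  integer. Injectivity on the circle forces \<open>d\<close> to be 1 or -1, and
  \<open>F = d * f\<close> is then increasing.\<close>

lemma circle_homeomorphism_lift:
  assumes hom: "homeomorphism (sphere 0 1) (sphere 0 1) \<phi> \<psi>"
  obtains F :: "real \<Rightarrow> real" and d :: real
  where "d = 1 \<or> d = -1" "continuous_on UNIV F" "strict_mono F"
    "\<And>t. F (t + 2 * pi) = F t + 2 * pi" "\<And>t. \<phi> (cis t) = cis (d * F t)"
proof -
  have inj: "cis s = cis t" if "\<phi> (cis s) = \<phi> (cis t)" for s t
    using that hom by (metis homeomorphism_def mem_sphere_0 norm_cis)
  have "continuous_on UNIV cis" unfolding cis_conv_exp by (intro continuous_intros)
  then have c: "continuous_on UNIV (\<lambda>t. \<phi> (cis t))"
    by (rule continuous_on_compose2[OF homeomorphism_cont1[OF hom]]) auto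
  have n1: "cmod (\<phi> (cis t)) = 1" for t
  proof -
    have "\<phi> (cis t) \<in> sphere 0 1" using homeomorphism_image1[OF hom] by (metis image_eqI mem_sphere_0 norm_cis)
    then show ?thesis by simp
  qed
  have nz: "\<phi> (cis t) \<noteq> 0" for t using n1[of t] by auto
  obtain g where g: "continuous_on UNIV g" "\<And>t::real. \<phi> (cis t) = exp (g t)"
    using continuous_logarithm_on_contractible[OF c contractible_UNIV nz] by (metis UNIV_I)
  define f where "f t = Im (g t)" for t
  have f: "\<phi> (cis t) = cis (f t)" for t
  proof -
    have "Re (g t) = 0" using n1[of t] by (simp add: g)
    then have "g t = \<i> * of_real (f t)" by (simp add: f_def complex_eq_iff)
    then show ?thesis using g(2)[of t] by (simp add: cis_conv_exp)
  qed
  have fc: "continuous_on S f" for S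
    unfolding f_def by (intro continuous_intros continuous_on_subset[OF g(1)]) auto
  have per: "\<exists>k::int. f (t + 2 * pi * of_int j) = f t + 2 * pi * of_int k" for t j
  proof -
    have "cis (t + 2 * pi * of_int j) = cis t" using cis_eq_iff by blast
    then show ?thesis using f cis_eq_iff by metis
  qed
  have finj: "\<exists>k::int. s = t + 2 * pi * of_int k" if "f s = f t + 2 * pi * of_int j" for s t j
  proof -
    have "cis (f s) = cis (f t)" unfolding cis_eq_iff using that by blast
    then show ?thesis using inj f cis_eq_iff by metis
  qed
  define m where "m t = (f (t + 2 * pi) - f t) / (2 * pi)" for t
  have m_int: "m t \<in> \<int>" for t using per[of t 1] by (auto simp: m_def)
  \<comment> \<open>A continuous integer-valued function on the line is constant; the constant is
    the degree.\<close>
  have "m constant_on UNIV"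
  proof (rule continuous_discrete_range_constant)
    have "continuous_on UNIV (\<lambda>t. f (t + 2 * pi))"
      by (rule continuous_on_compose2[OF fc[of UNIV]]) (auto intro!: continuous_intros)
    then show "continuous_on UNIV m" unfolding m_def by (intro continuous_intros fc) auto
    fix x :: real
    show "\<exists>e>0. \<forall>y. y \<in> UNIV \<and> m y \<noteq> m x \<longrightarrow> e \<le> norm (m y - m x)"
    proof (intro exI[of _ 1] conjI allI impI)
      fix y assume "y \<in> UNIV \<and> m y \<noteq> m x"
      then show "1 \<le> norm (m y - m x)" using Ints_nonzero_abs_ge1[of "m y - m x"] m_int by auto
    qed simp
  qed simp
  then obtain d where d: "\<And>t. m t = d" by (auto simp: constant_on_def)
  then have shift: "f (t + 2 * pi) = f t + 2 * pi * d" for t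
    using d[of t] by (simp add: m_def field_simps)
  have "d \<in> \<int>" using m_int d by metis
  have circle: "s = t \<or> (s = 0 \<and> t = 2 * pi)"
    if st: "0 \<le> s" "s \<le> t" "t \<le> 2 * pi" "f s = f t + 2 * pi * of_int j" for s t j
  proof -
    obtain k :: int where k: "s = t + 2 * pi * of_int k" using finj st(4) by blast
    then have "2 * pi * of_int k \<le> 2 * pi * 0" "2 * pi * (-1) \<le> 2 * pi * of_int k" using st by auto
    then have "of_int k \<le> (0::real)" "-1 \<le> (of_int k::real)"
      using mult_left_le_imp_le[of "2 * pi"] pi_gt_zero by (metis mult_pos_pos zero_less_numeral)+
    then have "k = 0 \<or> k = -1" by linarith
    then show ?thesis using k st by auto
  qed
  have "d \<noteq> 0"
  proof
    assume "d = 0"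
    then have f2: "f (2 * pi) = f 0" using shift[of 0] by simp
    \<comment> \<open>For degree 0 the lift returns to its initial value, so this midpoint value is
      attained on both halves of the period, at points that injectivity must identify.\<close>
    define v where "v = (f 0 + f pi) / 2"
    have ne: "f 0 \<noteq> f pi" using circle[of 0 pi 0] by auto
    have "\<exists>s. 0 \<le> s \<and> s \<le> pi \<and> f s = v"
      using IVT'[of f 0 v pi] IVT2'[of f pi v 0] fc by (cases "f 0 \<le> f pi") (auto simp: v_def)
    moreover have "\<exists>t. pi \<le> t \<and> t \<le> 2 * pi \<and> f t = v"
      using IVT'[of f pi v "2 * pi"] IVT2'[of f "2 * pi" v pi] fc f2 by (cases "f 0 \<le> f pi") (auto simp: v_def)
    ultimately obtain s t where st: "0 \<le> s" "s \<le> pi" "f s = v" "pi \<le> t" "t \<le> 2 * pi" "f t = v" by auto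
    then have "s = pi \<or> s = 0" using circle[of s t 0] by auto
    then show False using st ne by (auto simp: v_def)
  qed
  have d1: "\<bar>d\<bar> = 1"
  proof (rule ccontr)
    assume "\<bar>d\<bar> \<noteq> 1"
    then have d2: "\<bar>d\<bar> > 1" using \<open>d \<noteq> 0\<close> Ints_nonzero_abs_ge1[OF \<open>d \<in> \<int>\<close>] by simp
    have f2: "f (2 * pi) = f 0 + 2 * pi * d" using shift[of 0] by simp
    \<comment> \<open>For degree above 1 in modulus, the value one full turn from \<open>f 0\<close>
      is reached strictly inside the period, contradicting \<open>circle\<close>.\<close>
    have "\<exists>t j. 0 \<le> t \<and> t \<le> 2 * pi \<and> f t = f 0 + 2 * pi * of_int j \<and> \<bar>j\<bar> = 1"
    proof (cases "d > 0")
      case True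
      then have "f 0 + 2 * pi * 1 \<le> f 0 + 2 * pi * d" using d2 by (intro add_left_mono mult_left_mono) auto
      then show ?thesis using IVT'[of f 0 "f 0 + 2 * pi" "2 * pi"] fc f2 by force
    next
      case False
      then have "f 0 + 2 * pi * d \<le> f 0 + 2 * pi * (-1)" using d2 by (intro add_left_mono mult_left_mono) auto
      then obtain t where "0 \<le> t" "t \<le> 2 * pi" "f t = f 0 + 2 * pi * of_int (-1)"
        using IVT2'[of f "2 * pi" "f 0 - 2 * pi" 0] fc f2 by auto
      then show ?thesis by (intro exI[of _ t] exI[of _ "-1"]) auto
    qed
    then obtain t j where t: "0 \<le> t" "t \<le> 2 * pi" "f t = f 0 + 2 * pi * of_int j" "\<bar>j\<bar> = 1" by auto
    then have "f 0 = f t + 2 * pi * of_int (- j)" by simp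
    then have "0 = t \<or> t = 2 * pi" using circle[of 0 t "- j"] t by blast
    then show False using t d2 f2 \<open>d \<noteq> 0\<close> by auto
  qed
  define F where "F t = d * f t" for t
  have dd: "d * d = 1" using d1 by (metis abs_mult_self_eq mult_1)
  have Fs: "F (t + 2 * pi) = F t + 2 * pi" for t
  proof -
    have "d * f (t + 2 * pi) = d * f t + 2 * pi * (d * d)" unfolding shift by (simp add: algebra_simps)
    then show ?thesis by (simp add: F_def dd)
  qed
  have Fn: "F (t + 2 * pi * real n) = F t + 2 * pi * real n" for t n
    using Fs by (rule shift_of_nat)
  have Fc: "continuous_on S F" for S unfolding F_def by (intro continuous_intros fc)
  have Finj: "inj F"
  proof (rule injI)
    fix s t assume "F s = F t"
    then have fst: "f s = f t" using \<open>d \<noteq> 0\<close> by (simp add: F_def)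
    have *: "a = b" if ab: "a \<le> b" "f a = f b" for a b
    proof -
      obtain k :: int where k: "b = a + 2 * pi * of_int k" using finj[of b a 0] ab by auto
      then have "0 \<le> 2 * pi * of_int k" using ab by simp
      then have "0 \<le> k" using pi_gt_zero by (auto simp: zero_le_mult_iff)
      then have "F b = F a + 2 * pi * of_int k" using Fn[of a "nat k"] k by simp
      then show ?thesis using k ab by (simp add: F_def)
    qed
    show "s = t" using *[of s t] *[of t s] fst by (cases "s \<le> t") auto
  qed
  have "strict_mono F"
  proof (rule strict_monoI)
    fix s t :: real assume st: "s < t"
    obtain n :: nat where n: "(t - s) / (2 * pi) < of_nat n" using reals_Archimedean2 by blast
    then have tn: "t < s + 2 * pi * real n" by (simp add: field_simps)
    \<comment> \<open>A continuous injective function is monotone on the triple; the shift by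
      \<open>n\<close> periods decides the direction.\<close>
    have "(F s < F t \<and> F t < F (s + 2 * pi * real n)) \<or> (F (s + 2 * pi * real n) < F t \<and> F t < F s)"
      by (rule continuous_inj_imp_mono[OF st tn Fc]) (use Finj in \<open>auto intro: inj_on_subset\<close>)
    moreover have "F s \<le> F (s + 2 * pi * real n)" by (simp add: Fn)
    ultimately show "F s < F t" by linarith
  qed
  moreover have "d = 1 \<or> d = -1" using d1 by linarith
  moreover have "d * F t = f t" for t using dd by (simp add: F_def mult.assoc[symmetric])
  ultimately show ?thesis using that[of d F] Fc Fs f by simp
qed

section \<open>Assembling the homeomorphism\<close>

lemma expanding_lift_average:
  assumes "continuous_on UNIV F" "mono F" "\<And>t. F (t + 2 * pi) = F t + 2 * pi"
  shows "expanding_lift (\<lambda>t. (t + F t) / 2)"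
proof
  show "continuous_on UNIV (\<lambda>t. (t + F t) / 2)" using assms(1) by (intro continuous_intros) auto
  show "(x + 2 * pi + F (x + 2 * pi)) / 2 = (x + F x) / 2 + 2 * pi" for x using assms(3) by simp
  show "(y - x) / 2 \<le> (y + F y) / 2 - (x + F x) / 2" if "x \<le> y" for x y
    using monoD[OF assms(2) that] by (simp add: field_simps)
qed

text \<open>The integral condition for \<open>\<Phi> t = t\<close>, in the shape in which
  \<open>dilatation_integral_finite\<close> takes it; through it the same estimate yields the
  integrable differential demanded by \<open>sobolev_W11\<close>.\<close>

lemma nn_integral_inverse_square_finite:
  "(\<integral>\<^sup>+t\<in>{1..}. ennreal (t / t ^ 3) \<partial>lborel) < \<infinity>"
proof -
  have "(\<integral>\<^sup>+t. ennreal (t / t ^ 3) * indicator {1..} t \<partial>lborel) = ennreal (0 - (- inverse 1))"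
  proof (rule nn_integral_FTC_atLeast)
    show "((\<lambda>t. - inverse t) has_real_derivative x / x ^ 3) (at x)" if "1 \<le> x" for x :: real
      using that by (auto intro!: derivative_eq_intros simp: power2_eq_square power3_eq_cube field_simps)
    show "0 \<le> x / x ^ 3" if "1 \<le> x" for x :: real using that by simp
    show "((\<lambda>t::real. - inverse t) \<longlongrightarrow> 0) at_top"
    proof -
      have "((\<lambda>t::real. inverse t) \<longlongrightarrow> 0) at_top" by (rule tendsto_inverse_0_at_top[OF filterlim_ident])
      from tendsto_minus[OF this] show ?thesis by simp
    qed
  qed simp
  then show ?thesis by simp
qed

text \<open>Off the origin the differential of \<open>g\<close> is bounded by 4,
  \<open>\<sigma>\<close> preserves the norm and the differential of \<open>ext\<close> is at most
  \<open>4 * dil\<close>, hence the majorant \<open>16 * dil\<close>. Exchanging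
  \<open>\<alpha>\<close> and \<open>\<beta>\<close> covers the inverse map as well.\<close>

lemma inverse_ext_comp_ext_orlicz_sobolev:
  assumes \<alpha>: "expanding_lift \<alpha>" and \<beta>: "expanding_lift \<beta>"
    and g: "homeomorphism (cball 0 1) (cball 0 1) (expanding_lift.ext \<beta>) g"
    and \<sigma>: "bounded_linear \<sigma>" "\<And>z. cmod (\<sigma> z) = cmod z"
    and \<Phi>: "N_function \<Phi>" "(\<integral>\<^sup>+t\<in>{1..}. ennreal (\<Phi> t / t ^ 3) \<partial>lborel) < \<infinity>"
  shows "(\<lambda>z. g (\<sigma> (expanding_lift.ext \<alpha> z))) \<in> orlicz_sobolev \<Phi> (ball 0 1)"
proof -
  interpret A: expanding_lift \<alpha> by fact
  interpret B: expanding_lift \<beta> by fact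
  define D where "D z = (SOME D. ((\<lambda>z. g (\<sigma> (A.ext z))) has_derivative D) (at z) \<and> onorm D \<le> 16 * A.dil z)" for z
  have D: "((\<lambda>z. g (\<sigma> (A.ext z))) has_derivative D z) (at z) \<and> onorm (D z) \<le> 16 * A.dil z"
    if z: "z \<in> ball 0 1 - {0}" for z
  proof -
    have "\<sigma> (A.ext z) \<in> ball 0 1 - {0}" using z \<sigma>(2)[of "A.ext z"] by auto
    then obtain D2 where D2: "(g has_derivative D2) (at (\<sigma> (A.ext z)))" "\<And>h. cmod (D2 h) \<le> 4 * cmod h"
      using B.ext_inverse_has_derivative[OF g] by blast
    let ?D = "\<lambda>h. D2 (\<sigma> (A.ext z * A.log_deriv (Ln z) (h / z)))"
    have "((\<lambda>z. g (\<sigma> (A.ext z))) has_derivative ?D) (at z)"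
      by (rule has_derivative_compose[OF bounded_linear.has_derivative[OF \<sigma>(1) A.ext_has_derivative[OF z]] D2(1)])
    moreover have "onorm ?D \<le> 16 * A.dil z"
    proof (rule onorm_le)
      fix h
      have "cmod (?D h) \<le> 4 * cmod (A.ext z * A.log_deriv (Ln z) (h / z))" using D2(2) \<sigma>(2) by metis
      also have "\<dots> \<le> 4 * (4 * A.dil z * cmod h)" by (intro mult_left_mono A.ext_derivative_bound[OF z]) simp
      finally show "cmod (?D h) \<le> 16 * A.dil z * cmod h" by simp
    qed
    ultimately have "\<exists>D. ((\<lambda>z. g (\<sigma> (A.ext z))) has_derivative D) (at z) \<and> onorm D \<le> 16 * A.dil z"
      by (intro exI[of _ ?D] conjI)
    then show ?thesis unfolding D_def by (rule someI_ex)
  qed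
  have "convex_on {0..} (\<lambda>t::real. t)" by (rule convex_on_ident[THEN iffD2]) (rule convex_real_interval)
  then have id: "(\<integral>\<^sup>+z\<in>ball 0 1. ennreal (16 * A.dil z) \<partial>lebesgue) < \<infinity>"
    by (intro A.dilatation_integral_finite[where \<Phi> = "\<lambda>t. t"] nn_integral_inverse_square_finite mono_onI) auto
  have \<Phi>i: "(\<integral>\<^sup>+z\<in>ball 0 1. ennreal (\<Phi> (16 * A.dil z)) \<partial>lebesgue) < \<infinity>"
    by (rule A.dilatation_integral_finite[OF _ _ _ _ \<Phi>(2)]) (use \<Phi>(1) in \<open>auto simp: N_function_def\<close>)
  show ?thesis
  proof (rule orlicz_sobolevI[OF _ _ _ _ _ id \<Phi>i])
    have "continuous_on (cball 0 1) (\<lambda>z. \<sigma> (A.ext z))"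
      by (rule bounded_linear.continuous_on[OF \<sigma>(1) A.continuous_on_ext])
    then show "continuous_on (cball 0 1) (\<lambda>z. g (\<sigma> (A.ext z)))"
      by (rule continuous_on_compose2[OF homeomorphism_cont2[OF g]]) (simp add: \<sigma>(2) image_subset_iff)
    show "mono_on {0..} \<Phi>" using \<Phi>(1) by (simp add: N_function_def)
  qed (use D in \<open>auto simp: A.dil_def\<close>)
qed

theorem corollary1p3:
  fixes \<Phi> :: "real \<Rightarrow> real" and \<phi> :: "complex \<Rightarrow> complex"
  assumes "N_function \<Phi>"
    and "doubling \<Phi>"
    and "(\<integral>\<^sup>+t\<in>{1..}. ennreal (\<Phi> t / t ^ 3) \<partial>lborel) < \<infinity>"
    and "\<exists>\<psi>. homeomorphism (sphere 0 1) (sphere 0 1) \<phi> \<psi>"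
  shows "\<exists>h h_inv. homeomorphism (cball 0 1) (cball 0 1) h h_inv \<and>
           (\<forall>z\<in>sphere 0 1. h z = \<phi> z) \<and>
           h \<in> orlicz_sobolev \<Phi> (ball 0 1) \<and> h_inv \<in> orlicz_sobolev \<Phi> (ball 0 1)"
proof -
  obtain F :: "real \<Rightarrow> real" and d :: real
    where d: "d = 1 \<or> d = -1" and F: "continuous_on UNIV F" "strict_mono F"
      "\<And>t. F (t + 2 * pi) = F t + 2 * pi" and \<phi>: "\<And>t. \<phi> (cis t) = cis (d * F t)"
    using circle_homeomorphism_lift assms(4) by metis
  have alpha: "expanding_lift (\<lambda>t. (t + F t) / 2)"
    using F by (intro expanding_lift_average strict_mono_mono)
  interpret A: expanding_lift "\<lambda>t. (t + F t) / 2" by (rule alpha)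
  have "inj F" using F(2) by (rule strict_mono_imp_inj_on)
  have "surj F" using F(1,3) by (rule surj_of_shift) simp
  define G where "G u = d * inv F (d * u)" for u
  have dd: "d * (d * x) = x" for x using d by auto
  have FG: "d * F (d * G u) = u" for u using \<open>surj F\<close> by (simp add: G_def dd surj_f_inv_f)
  have GF: "G (d * F t) = d * t" for t using \<open>inj F\<close> by (simp add: G_def dd)
  have "strict_mono G"
  proof (rule strict_monoI)
    fix u v :: real assume "u < v"
    have inv: "inv F a < inv F b" if "a < b" for a b
      using that \<open>surj F\<close> by (metis strict_mono_less[OF F(2)] surj_f_inv_f)
    show "G u < G v" using d inv[of u v] inv[of "- v" "- u"] \<open>u < v\<close> by (auto simp: G_def)
  qed
  \<comment> \<open>A monotone function with open range is continuous.\<close>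
  have "continuous_on UNIV G"
  proof (rule continuous_onI_mono)
    have "range G = UNIV"
    proof (intro equalityI subsetI)
      fix x :: real
      have "x = G (d * F (d * x))" by (simp add: GF dd)
      then show "x \<in> range G" by blast
    qed simp
    then show "open (range G)" by simp
  qed (use \<open>strict_mono G\<close> in \<open>simp add: strict_mono_less_eq\<close>)
  moreover have "G (u + 2 * pi) = G u + 2 * pi" for u
  proof -
    \<comment> \<open>For \<open>d = -1\<close> the period relation of \<open>F\<close> is read
      backwards, hence the instance at a point shifted by \<open>- 2 * pi\<close>.\<close>
    have "F (d * G u + d * (2 * pi)) = F (d * G u) + d * (2 * pi)"
      using d F(3)[of "d * G u"] F(3)[of "d * G u - 2 * pi"] by auto
    then have "d * F (d * (G u + 2 * pi)) = u + 2 * pi"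
      using FG[of u] by (simp add: algebra_simps dd)
    then show ?thesis using GF[of "d * (G u + 2 * pi)"] by (simp add: dd)
  qed
  ultimately have beta: "expanding_lift (\<lambda>t. (t + G t) / 2)"
    using \<open>strict_mono G\<close> by (intro expanding_lift_average strict_mono_mono)
  interpret B: expanding_lift "\<lambda>t. (t + G t) / 2" by (rule beta)
  obtain gA where gA: "homeomorphism (cball 0 1) (cball 0 1) A.ext gA" by (rule A.homeomorphism_ext)
  obtain gB where gB: "homeomorphism (cball 0 1) (cball 0 1) B.ext gB" by (rule B.homeomorphism_ext)
  define \<sigma> where "\<sigma> z = (if d = 1 then z else cnj z)" for z
  have \<sigma>n: "cmod (\<sigma> z) = cmod z" for z by (simp add: \<sigma>_def)
  have \<sigma>l: "bounded_linear \<sigma>"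
    using bounded_linear_ident bounded_linear_cnj by (cases "d = 1") (simp_all add: \<sigma>_def[abs_def])
  have \<sigma>\<sigma>: "\<sigma> (\<sigma> z) = z" for z by (simp add: \<sigma>_def)
  have \<sigma>cis: "\<sigma> (cis t) = cis (d * t)" for t using d by (auto simp: \<sigma>_def cis_cnj)
  have "homeomorphism (cball 0 1) (cball 0 1) \<sigma> \<sigma>"
    by (intro homeomorphismI linear_continuous_on \<sigma>l) (simp_all add: \<sigma>n \<sigma>\<sigma> image_subset_iff)
  \<comment> \<open>Because \<open>\<sigma>\<close> is an involution, the inverse has the same form
    with the two lifts interchanged.\<close>
  from homeomorphism_compose[OF homeomorphism_compose[OF gA this] homeomorphism_symD[OF gB]]
  have "homeomorphism (cball 0 1) (cball 0 1) (\<lambda>z. gB (\<sigma> (A.ext z))) (\<lambda>z. gA (\<sigma> (B.ext z)))"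
    by (simp only: o_def)
  moreover have "gB (\<sigma> (A.ext z)) = \<phi> z" if "z \<in> sphere 0 1" for z
  proof -
    have "z \<noteq> 0" "sgn z = z" using that by (auto simp: sgn_div_norm)
    then have "z = cis (Arg z)" using cis_Arg[of z] by simp
    then obtain t where t: "z = cis t" by blast
    have "\<sigma> (A.ext z) = cis (d * ((t + F t) / 2))" by (simp add: t A.ext_cis \<sigma>cis)
    \<comment> \<open>The relation \<open>\<beta> (d * F t) = d * \<alpha> t\<close> between the two
      averages is what makes the boundary values agree with \<open>\<phi>\<close>.\<close>
    also have "d * ((t + F t) / 2) = (d * F t + G (d * F t)) / 2" by (simp add: GF algebra_simps)
    also have "cis \<dots> = B.ext (\<phi> z)" by (simp add: t \<phi> B.ext_cis)
    finally show ?thesis using gB by (simp add: homeomorphism_def t \<phi>)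
  qed
  ultimately show ?thesis
    using inverse_ext_comp_ext_orlicz_sobolev[OF alpha beta gB \<sigma>l \<sigma>n assms(1,3)]
      inverse_ext_comp_ext_orlicz_sobolev[OF beta alpha gA \<sigma>l \<sigma>n assms(1,3)] by blast
qed

end
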